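(* Let $1<m<\infty$, $n\ge2$, $s\ge1$, $w^*>0$ and $L\ge3$ be fixed, and let $d=sn$. For $\alpha>0$ let $\boldsymbol W_{L:1}(\infty)$ be the limit as $t\to\infty$ of $\boldsymbol W_{L:1}(t)=\boldsymbol W_L(t)\cdots\boldsymbol W_1(t)$, where the factors $\boldsymbol W_l(t)\in\mathbb R^{d\times d}$ are each initialized as the matrix with diagonal entries $\alpha$ and off-diagonal entries $\alpha/m$ and evolve under the gradient flow of the squared loss on the block-diagonal observation set $\Omega_{\rm block}^{(s,n)}$ with all observed values equal to $w^*$. Then, as $\alpha\to0$, $$\mathrm{srank}\big(\boldsymbol W_{L:1}(\infty)\big)\to1.$$
   Context: $\Omega_{\rm block}^{(s,n)}=\bigcup_{b=1}^n\{(i,j): i,j\in\{(b-1)s+1,\dots,bs\}\}$. With $\phi(\boldsymbol W_1,\dots,\boldsymbol W_L)=\frac12\sum_{(i,j)\in\Omega_{\rm block}^{(s,n)}}\big((\boldsymbol W_L\cdots\boldsymbol W_1)_{ij}-w^*\big)^2$, gradient flow means $\dot{\boldsymbol W}_l(t)=-\partial\phi/\partial\boldsymbol W_l$ for all $l\in[L]$, $t\ge0$. The stable rank is $\mathrm{srank}(\boldsymbol W)=\|\boldsymbol W\|_F^2/\|\boldsymbol W\|_2^2$ (Frobenius and spectral norms). *)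

theory Defs
  imports "HOL-Analysis.Analysis"
begin

text \<open>
  The rows and columns of a matrix in \<open>real ^ 'd ^ 'd\<close> are indexed by the finite type \<open>'d\<close>;
  throughout, \<open>idx :: 'd \<Rightarrow> nat\<close> is the numbering of that type by \<open>1, \<dots>, s * n\<close>.
\<close>

definition Omega_block :: "('d::finite \<Rightarrow> nat) \<Rightarrow> nat \<Rightarrow> nat \<Rightarrow> ('d \<times> 'd) set" where
  "Omega_block idx s n =
     (\<Union>b\<in>{1..n}. {(i, j). idx i \<in> {(b - 1) * s + 1..b * s} \<and> idx j \<in> {(b - 1) * s + 1..b * s}})"

text \<open>\<open>layer_prod W L\<close> is \<open>W L ** \<dots> ** W 1\<close>; the value \<open>W 0\<close> is not used.\<close>

primrec layer_prod :: "(nat \<Rightarrow> real ^ 'd ^ 'd) \<Rightarrow> nat \<Rightarrow> real ^ 'd ^ 'd" where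
  "layer_prod W 0 = mat 1"
| "layer_prod W (Suc k) = W (Suc k) ** layer_prod W k"

definition block_loss ::
    "('d::finite \<Rightarrow> nat) \<Rightarrow> nat \<Rightarrow> nat \<Rightarrow> real \<Rightarrow> nat \<Rightarrow> (nat \<Rightarrow> real ^ 'd ^ 'd) \<Rightarrow> real" where
  "block_loss idx s n w L W =
     1 / 2 * (\<Sum>(i, j)\<in>Omega_block idx s n. (layer_prod W L $ i $ j - w)\<^sup>2)"

text \<open>
  \<open>G\<close> is the partial gradient with respect to the \<open>l\<close>-th factor. For matrices the inner product
  underlying \<open>GDERIV\<close> is the Frobenius one, so \<open>G\<close> is the matrix of partial derivatives with
  respect to the entries. At time \<open>0\<close> the time derivative is one-sided.
\<close>

definition gradient_flow ::
    "((nat \<Rightarrow> 'a::real_inner) \<Rightarrow> real) \<Rightarrow> nat \<Rightarrow> (nat \<Rightarrow> real \<Rightarrow> 'a) \<Rightarrow> bool" where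
  "gradient_flow \<phi> L W \<longleftrightarrow>
     (\<forall>l\<in>{1..L}. \<forall>t\<ge>0. \<exists>G.
        (GDERIV (\<lambda>X. \<phi> ((\<lambda>k. W k t)(l := X))) (W l t) :> G) \<and>
        (W l has_vector_derivative - G) (at t within {0..}))"

definition init_matrix :: "real \<Rightarrow> real \<Rightarrow> real ^ 'd ^ 'd" where
  "init_matrix \<alpha> m = (\<chi> i j. if i = j then \<alpha> else \<alpha> / m)"

text \<open>The library norm on \<open>real ^ 'd ^ 'd\<close> is the Frobenius norm.\<close>

definition srank :: "real ^ 'd ^ 'd \<Rightarrow> real" where
  "srank A = (norm A)\<^sup>2 / (onorm ((*v) A))\<^sup>2"

end

theory Submission
  imports Defs
begin

text \<open>
  Tuples whose \<open>L\<close> factors are all equal to one matrix of the commutative algebra spanned by the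
  identity, the block indicator and the all-ones matrix form a linear subspace that the gradient maps
  to itself, so by Gronwall's inequality the flow never leaves it. There it is a flow of three
  eigenvalues: \<open>x\<close> on the constant vectors, \<open>y\<close> on the vectors that are constant on blocks and have
  sum zero, and \<open>z\<close> on the vectors with sum zero in every block. It reads
  \<open>x' = - x\<^sup>L\<^sup>-\<^sup>1 \<mu>\<close> and \<open>y' = - y\<^sup>L\<^sup>-\<^sup>1 \<mu>\<close> with the same residual
  \<open>\<mu> = x\<^sup>L / n + (1 - 1 / n) y\<^sup>L - w s\<close>, while \<open>z' = - z\<^sup>2\<^sup>L\<^sup>-\<^sup>1\<close> decays to zero. The sign of \<open>\<mu>\<close>
  does not change, so \<open>x\<close> and \<open>y\<close> are monotone, converge, and \<open>\<mu>\<close> tends to zero. Since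
  \<open>1 / y\<^sup>L\<^sup>-\<^sup>2 - 1 / x\<^sup>L\<^sup>-\<^sup>2\<close> is conserved and scales like \<open>\<alpha>\<^sup>2\<^sup>-\<^sup>L\<close>, the limit of \<open>y\<close> is \<open>O(\<alpha>)\<close>,
  whereas \<open>x\<^sup>L\<close> tends to \<open>n s w\<close>: the limiting product is asymptotically of rank one.
\<close>

section \<open>Scalar differential inequalities\<close>

text \<open>The derivative is taken within \<open>{0..}\<close> to match the one-sided derivative of
  \<open>gradient_flow\<close> at time 0. At interior points it is the ordinary derivative, and
  continuity covers the endpoints.\<close>

lemma nonincreasing_within:
  fixes f :: "real \<Rightarrow> real"
  assumes der: "\<And>t. t \<ge> 0 \<Longrightarrow> (f has_real_derivative f' t) (at t within {0..})"
    and nonpos: "\<And>t. a \<le> t \<Longrightarrow> t \<le> b \<Longrightarrow> f' t \<le> 0"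
    and ab: "0 \<le> a" "a \<le> b"
  shows "f b \<le> f a"
proof (rule DERIV_nonpos_imp_decreasing_open[OF ab(2)])
  fix t assume t: "a < t" "t < b"
  then have "at t within {0..} = at t"
    using ab by (intro at_within_interior) auto
  then show "\<exists>y. DERIV f t :> y \<and> y \<le> 0"
    using der[of t] nonpos[of t] t ab by auto
next
  have "continuous_on {0..} f"
    by (rule DERIV_continuous_on[of _ _ f']) (use der in auto)
  then show "continuous_on {a..b} f"
    by (rule continuous_on_subset) (use ab in auto)
qed

text \<open>The integrating factor \<open>exp (- K * t)\<close> turns the differential inequality
  into monotonicity. \<open>K\<close> may have either sign.\<close>

lemma gronwall_within:
  fixes u :: "real \<Rightarrow> real"
  assumes der: "\<And>t. t \<ge> 0 \<Longrightarrow> (u has_real_derivative u' t) (at t within {0..})"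
    and le: "\<And>t. 0 \<le> t \<Longrightarrow> t \<le> T \<Longrightarrow> u' t \<le> K * u t"
    and T: "0 \<le> T"
  shows "u T \<le> u 0 * exp (K * T)"
proof -
  have "u T * exp (- K * T) \<le> u 0 * exp (- K * 0)"
  proof (rule nonincreasing_within[of "\<lambda>t. u t * exp (- K * t)"
        "\<lambda>t. (u' t - K * u t) * exp (- K * t)" 0 T])
    fix t :: real assume "t \<ge> 0"
    then show "((\<lambda>t. u t * exp (- K * t)) has_real_derivative (u' t - K * u t) * exp (- K * t))
        (at t within {0..})"
      by (auto intro!: derivative_eq_intros der simp: algebra_simps)
  next
    fix t assume "0 \<le> t" "t \<le> T"
    then show "(u' t - K * u t) * exp (- K * t) \<le> 0"
      using le by (simp add: mult_nonpos_nonneg)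
  qed (use T in auto)
  then show ?thesis
    by (simp add: exp_minus field_simps)
qed

lemma continuous_on_bounded_interval:
  fixes f g :: "real \<Rightarrow> real"
  assumes "continuous_on {0..} g" "0 \<le> T"
  obtains K where "\<And>t. 0 \<le> t \<Longrightarrow> t \<le> T \<Longrightarrow> \<bar>g t\<bar> \<le> K"
proof -
  have "bounded (g ` {0..T})"
    using assms by (intro compact_imp_bounded compact_continuous_image) (auto intro: continuous_on_subset)
  then obtain K where "\<And>y. y \<in> g ` {0..T} \<Longrightarrow> norm y \<le> K"
    unfolding bounded_iff by auto
  then show ?thesis
    using that[of K] by auto
qed

lemma linear_ode_nonzero:
  fixes f g :: "real \<Rightarrow> real"
  assumes der: "\<And>t. t \<ge> 0 \<Longrightarrow> (f has_real_derivative g t * f t) (at t within {0..})"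
    and g: "continuous_on {0..} g" and T: "T \<ge> 0" and f0: "f 0 \<noteq> 0"
  shows "f T \<noteq> 0"
proof -
  obtain K where K: "\<And>t. 0 \<le> t \<Longrightarrow> t \<le> T \<Longrightarrow> \<bar>g t\<bar> \<le> K"
    using continuous_on_bounded_interval[OF g T] by blast
  \<comment> \<open>Gronwall for the negated square gives a lower bound: the square decays at most
    exponentially while the coefficient is bounded by \<open>K\<close>.\<close>
  have "- (f T)\<^sup>2 \<le> - (f 0)\<^sup>2 * exp (- 2 * K * T)"
  proof (rule gronwall_within[of "\<lambda>t. - (f t)\<^sup>2" "\<lambda>t. - 2 * g t * (f t)\<^sup>2" T "- 2 * K"])
    fix t :: real assume "t \<ge> 0"
    then show "((\<lambda>t. - (f t)\<^sup>2) has_real_derivative - 2 * g t * (f t)\<^sup>2) (at t within {0..})"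
      by (auto intro!: derivative_eq_intros der simp: power2_eq_square)
  next
    fix t assume "0 \<le> t" "t \<le> T"
    then have "- g t * (f t)\<^sup>2 \<le> K * (f t)\<^sup>2"
      using K[of t] by (intro mult_right_mono) auto
    then show "- 2 * g t * (f t)\<^sup>2 \<le> - 2 * K * - (f t)\<^sup>2"
      by simp
  qed (rule T)
  moreover have "(f 0)\<^sup>2 * exp (- 2 * K * T) > 0"
    using f0 by simp
  ultimately show ?thesis
    by auto
qed

lemma linear_ode_zero:
  fixes f g :: "real \<Rightarrow> real"
  assumes der: "\<And>t. t \<ge> 0 \<Longrightarrow> (f has_real_derivative g t * f t) (at t within {0..})"
    and g: "continuous_on {0..} g" and T: "T \<ge> 0" and f0: "f 0 = 0"
  shows "f T = 0"
proof -
  obtain K where K: "\<And>t. 0 \<le> t \<Longrightarrow> t \<le> T \<Longrightarrow> \<bar>g t\<bar> \<le> K"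
    using continuous_on_bounded_interval[OF g T] by blast
  have "(f T)\<^sup>2 \<le> (f 0)\<^sup>2 * exp (2 * K * T)"
  proof (rule gronwall_within[of "\<lambda>t. (f t)\<^sup>2" "\<lambda>t. 2 * g t * (f t)\<^sup>2" T "2 * K"])
    fix t :: real assume "t \<ge> 0"
    then show "((\<lambda>t. (f t)\<^sup>2) has_real_derivative 2 * g t * (f t)\<^sup>2) (at t within {0..})"
      by (auto intro!: derivative_eq_intros der simp: power2_eq_square)
  next
    fix t assume "0 \<le> t" "t \<le> T"
    then have "g t * (f t)\<^sup>2 \<le> K * (f t)\<^sup>2"
      using K[of t] by (intro mult_right_mono) auto
    then show "2 * g t * (f t)\<^sup>2 \<le> 2 * K * (f t)\<^sup>2"
      by simp
  qed (rule T)
  then show ?thesis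
    using f0 by simp
qed

text \<open>Losing positivity would force a zero by the intermediate value theorem, which
  \<open>linear_ode_nonzero\<close> excludes.\<close>

lemma linear_ode_pos:
  fixes f g :: "real \<Rightarrow> real"
  assumes der: "\<And>t. t \<ge> 0 \<Longrightarrow> (f has_real_derivative g t * f t) (at t within {0..})"
    and g: "continuous_on {0..} g" and T: "T \<ge> 0" and f0: "f 0 > 0"
  shows "f T > 0"
proof (rule ccontr)
  assume "\<not> f T > 0"
  moreover have "continuous_on {0..T} f"
    by (rule continuous_on_subset[OF DERIV_continuous_on[of "{0..}" f "\<lambda>t. g t * f t"]])
      (use der in auto)
  ultimately obtain t where "0 \<le> t" "t \<le> T" "f t = 0"
    using IVT2'[of f T 0 0] T f0 by auto
  then show False
    using linear_ode_nonzero[OF der g, of t] f0 by simp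
qed

section \<open>Convergence of monotone functions and limits of derivatives\<close>

lemma nonincreasing_convergent:
  fixes f :: "real \<Rightarrow> real"
  assumes dec: "\<And>s t. 0 \<le> s \<Longrightarrow> s \<le> t \<Longrightarrow> f t \<le> f s"
    and lb: "\<And>t. 0 \<le> t \<Longrightarrow> B \<le> f t"
  obtains l where "(f \<longlongrightarrow> l) at_top"
proof
  have bdd: "bdd_below (f ` {0..})"
    using lb by (auto intro!: bdd_belowI)
  show "(f \<longlongrightarrow> Inf (f ` {0..})) at_top"
  proof (rule decreasing_tendsto)
    show "\<forall>\<^sub>F t in at_top. Inf (f ` {0..}) \<le> f t"
      using eventually_ge_at_top[of 0]
      by eventually_elim (auto intro: cInf_lower bdd)
    fix x assume "Inf (f ` {0..}) < x"
    then obtain s where s: "0 \<le> s" "f s < x"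
      using bdd by (subst (asm) cInf_less_iff) auto
    show "\<forall>\<^sub>F t in at_top. f t < x"
      using eventually_ge_at_top[of s] by eventually_elim (use s dec in force)
  qed
qed

text \<open>If \<open>d\<close> were positive, \<open>f\<close> would eventually gain at least
  \<open>d / 2\<close> over every interval of length one, whereas the increments
  \<open>f (t + 1) - f t\<close> tend to 0.\<close>

lemma derivative_limit_nonpos:
  fixes f :: "real \<Rightarrow> real"
  assumes der: "\<And>t. t \<ge> 0 \<Longrightarrow> (f has_real_derivative f' t) (at t within {0..})"
    and f: "(f \<longlongrightarrow> l) at_top" and f': "(f' \<longlongrightarrow> d) at_top"
  shows "d \<le> 0"
proof (rule ccontr)
  assume "\<not> d \<le> 0"
  then have "\<forall>\<^sub>F t in at_top. f' t > d / 2"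
    using f' by (intro order_tendstoD) auto
  then obtain T where T: "\<And>t. t \<ge> T \<Longrightarrow> f' t > d / 2"
    by (auto simp: eventually_at_top_linorder)
  have "d / 2 \<le> f (t + 1) - f t" if t: "t \<ge> max T 0" for t
  proof -
    have "(d / 2 * (t + 1) - f (t + 1)) \<le> (d / 2 * t - f t)"
    proof (rule nonincreasing_within[of "\<lambda>t. d / 2 * t - f t" "\<lambda>t. d / 2 - f' t"])
      fix t :: real assume "t \<ge> 0"
      then show "((\<lambda>t. d / 2 * t - f t) has_real_derivative d / 2 - f' t) (at t within {0..})"
        by (auto intro!: derivative_eq_intros der)
    next
      fix s assume "t \<le> s" "s \<le> t + 1"
      then show "d / 2 - f' s \<le> 0"
        using T[of s] t by simp
    qed (use t in auto)
    then show ?thesis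
      by (simp add: field_simps)
  qed
  then have "\<forall>\<^sub>F t in at_top. d / 2 \<le> f (t + 1) - f t"
    unfolding eventually_at_top_linorder by blast
  moreover have "((\<lambda>t. f (t + 1)) \<longlongrightarrow> l) at_top"
    by (rule filterlim_compose[OF f])
      (rule filterlim_tendsto_add_at_top[OF tendsto_const[of 1] filterlim_ident, simplified add.commute[of 1]])
  then have "((\<lambda>t. f (t + 1) - f t) \<longlongrightarrow> l - l) at_top"
    by (intro tendsto_diff f)
  ultimately have "d / 2 \<le> l - l"
    by (intro tendsto_lowerbound) auto
  with \<open>\<not> d \<le> 0\<close> show False
    by simp
qed

lemma derivative_limit_zero:
  fixes f :: "real \<Rightarrow> real"
  assumes der: "\<And>t. t \<ge> 0 \<Longrightarrow> (f has_real_derivative f' t) (at t within {0..})"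
    and f: "(f \<longlongrightarrow> l) at_top" and f': "(f' \<longlongrightarrow> d) at_top"
  shows "d = 0"
proof -
  have "- d \<le> 0"
    by (rule derivative_limit_nonpos[of "\<lambda>t. - f t" "\<lambda>t. - f' t" "- l"])
      (auto intro!: tendsto_minus f f' DERIV_minus der)
  moreover have "d \<le> 0"
    by (rule derivative_limit_nonpos[OF der f f'])
  ultimately show ?thesis
    by simp
qed

text \<open>The square is nonincreasing whatever the sign of \<open>z\<close>, so it converges to
  some \<open>l\<close>. Its derivative then converges to \<open>- 2 * l ^ (k + 1)\<close>, which
  must be 0.\<close>

lemma odd_power_decay:
  fixes z :: "real \<Rightarrow> real"
  assumes der: "\<And>t. t \<ge> 0 \<Longrightarrow> (z has_real_derivative - (z t ^ (2 * k + 1))) (at t within {0..})"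
  shows "(z \<longlongrightarrow> 0) at_top"
proof -
  have der2: "((\<lambda>t. (z t)\<^sup>2) has_real_derivative - 2 * ((z t)\<^sup>2) ^ (k + 1)) (at t within {0..})"
    if "t \<ge> 0" for t
    by (rule derivative_eq_intros der that refl | simp add: power_mult power2_eq_square)+
  have "(z t)\<^sup>2 \<le> (z s)\<^sup>2" if "0 \<le> s" "s \<le> t" for s t
    by (rule nonincreasing_within[OF der2]) (use that in auto)
  then obtain l where l: "((\<lambda>t. (z t)\<^sup>2) \<longlongrightarrow> l) at_top"
    by (rule nonincreasing_convergent[of "\<lambda>t. (z t)\<^sup>2" 0]) auto
  have "- 2 * l ^ (k + 1) = 0"
    by (rule derivative_limit_zero[OF der2 l]) (auto intro!: tendsto_intros l)
  then have "((\<lambda>t. sqrt ((z t)\<^sup>2)) \<longlongrightarrow> sqrt 0) at_top"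
    using l by (intro tendsto_real_sqrt) auto
  then show ?thesis
    by (simp add: tendsto_rabs_zero_iff)
qed

section \<open>Two coupled eigenvalues\<close>

lemma nondecreasing_convergent:
  fixes f :: "real \<Rightarrow> real"
  assumes inc: "\<And>s t. 0 \<le> s \<Longrightarrow> s \<le> t \<Longrightarrow> f s \<le> f t"
    and ub: "\<And>t. 0 \<le> t \<Longrightarrow> f t \<le> B"
  obtains l where "(f \<longlongrightarrow> l) at_top"
proof -
  obtain l where "((\<lambda>t. - f t) \<longlongrightarrow> l) at_top"
    by (rule nonincreasing_convergent[of "\<lambda>t. - f t" "- B"]) (use inc ub in auto)
  then have "(f \<longlongrightarrow> - l) at_top"
    using tendsto_minus by fastforce
  then show ?thesis
    by (rule that)
qed

text \<open>Instantiated later with \<open>p = L - 2\<close>, \<open>c = 1 / n\<close> and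
  \<open>v = w * s\<close>. The exponent is shifted by two because \<open>p\<close> is the exponent
  in the conserved quantity.\<close>

locale coupled_flow =
  fixes x y \<mu> :: "real \<Rightarrow> real" and p :: nat and c v :: real
  assumes dx: "\<And>t. t \<ge> 0 \<Longrightarrow> (x has_real_derivative - (x t ^ (p + 1) * \<mu> t)) (at t within {0..})"
    and dy: "\<And>t. t \<ge> 0 \<Longrightarrow> (y has_real_derivative - (y t ^ (p + 1) * \<mu> t)) (at t within {0..})"
    and \<mu>: "\<And>t. \<mu> t = c * x t ^ (p + 2) + (1 - c) * y t ^ (p + 2) - v"
    and p: "p > 0" and c: "0 < c" "c < 1" and v: "v > 0"
    and init: "0 < y 0" "y 0 < x 0"
begin

lemma continuous: "continuous_on {0..} x" "continuous_on {0..} y" "continuous_on {0..} \<mu>"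
proof -
  show x: "continuous_on {0..} x"
    by (rule DERIV_continuous_on[of _ _ "\<lambda>t. - (x t ^ (p + 1) * \<mu> t)"]) (use dx in auto)
  show y: "continuous_on {0..} y"
    by (rule DERIV_continuous_on[of _ _ "\<lambda>t. - (y t ^ (p + 1) * \<mu> t)"]) (use dy in auto)
  show "continuous_on {0..} \<mu>"
    unfolding \<mu> by (intro continuous_intros x y)
qed

text \<open>Reading \<open>- (x t ^ p * \<mu> t)\<close> as a given continuous coefficient makes the
  equation for \<open>x\<close> linear, so positivity persists; likewise for
  \<open>y\<close>.\<close>

lemma pos: assumes "t \<ge> 0" shows "x t > 0" "y t > 0"
proof -
  have "continuous_on {0..} (\<lambda>t. - (x t ^ p * \<mu> t))" "continuous_on {0..} (\<lambda>t. - (y t ^ p * \<mu> t))"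
    by (intro continuous_intros continuous)+
  then show "x t > 0" "y t > 0"
    using linear_ode_pos[of x "\<lambda>t. - (x t ^ p * \<mu> t)" t]
      linear_ode_pos[of y "\<lambda>t. - (y t ^ p * \<mu> t)" t] dx dy init assms
    by (auto simp: mult_ac)
qed

lemma eventually_nonneg: "\<forall>\<^sub>F t in at_top. x t \<ge> 0" "\<forall>\<^sub>F t in at_top. y t \<ge> 0"
  using pos by (auto simp: eventually_at_top_linorder intro!: exI[of _ 0] less_imp_le)

text \<open>Both reciprocals \<open>1 / x t ^ p\<close> and \<open>1 / y t ^ p\<close> have the
  derivative \<open>p * \<mu> t\<close>, because the same residual drives both equations.\<close>

lemma conserved:
  assumes "t \<ge> 0"
  shows "1 / y t ^ p - 1 / x t ^ p = 1 / y 0 ^ p - 1 / x 0 ^ p"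
proof -
  let ?q = "\<lambda>t. 1 / y t ^ p - 1 / x t ^ p"
  have inv: "((\<lambda>t. 1 / u t ^ p) has_real_derivative p * \<mu> t) (at t within {0..})"
    if u: "(u has_real_derivative - (u t ^ (p + 1) * \<mu> t)) (at t within {0..})"
      and "u t > 0" for u t
  proof -
    obtain k where k: "p = Suc k"
      using p by (cases p) auto
    have "((\<lambda>t. u t ^ Suc k) has_real_derivative
        (1 + real k) * (- (u t ^ (Suc k + 1) * \<mu> t) * u t ^ k)) (at t within {0..})"
      using DERIV_power_Suc[OF u, of k] unfolding k by simp
    then have "((\<lambda>t. inverse (u t ^ Suc k)) has_real_derivative real (Suc k) * \<mu> t) (at t within {0..})"
      by (rule DERIV_cong[OF DERIV_inverse_fun]) (use that(2) in \<open>auto simp: field_simps\<close>)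
    then show ?thesis
      unfolding k by (simp add: inverse_eq_divide del: of_nat_Suc power_Suc)
  qed
  have der: "(?q has_real_derivative 0) (at t within {0..})" if "t \<ge> 0" for t
    by (rule derivative_eq_intros inv dx dy pos that | simp)+
  have "(?q has_derivative (\<lambda>h. 0)) (at s within {0..})" if "s \<in> {0..}" for s
    using der[of s] that by (simp add: has_field_derivative_def lambda_zero)
  then obtain C where "\<And>s. s \<in> {0..} \<Longrightarrow> ?q s = C"
    using has_derivative_zero_constant[of "{0..}" ?q] by auto
  then show ?thesis
    using assms by auto
qed

text \<open>For positive values the order of \<open>x\<close> and \<open>y\<close> is the sign of
  the conserved difference, which is positive at time 0.\<close>

lemma y_less_x: assumes "t \<ge> 0" shows "y t < x t"
proof -
  have "y 0 ^ p < x 0 ^ p"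
    using init p by (intro power_strict_mono) auto
  then have "1 / y 0 ^ p - 1 / x 0 ^ p > 0"
    using init by (simp add: field_simps)
  then have "1 / y t ^ p - 1 / x t ^ p > 0"
    using conserved[OF assms] by simp
  then have "y t ^ p < x t ^ p"
    using pos[OF assms] by (simp add: field_simps)
  then show ?thesis
    using pos[OF assms] by (auto intro: power_less_imp_less_base)
qed

text \<open>Both derivatives carry the factor \<open>\<mu> t\<close>, so the residual itself solves
  a linear equation with the continuous coefficient \<open>g\<close>. It is either always zero or
  keeps a strict sign.\<close>

lemma sign_persists:
  assumes "t \<ge> 0"
  shows "\<mu> 0 \<ge> 0 \<Longrightarrow> \<mu> t \<ge> 0" "\<mu> 0 < 0 \<Longrightarrow> \<mu> t < 0"
proof -
  define g where "g t = - (p + 2) * (c * x t ^ (2 * p + 2) + (1 - c) * y t ^ (2 * p + 2))" for t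
  have g: "continuous_on {0..} g"
    unfolding g_def by (intro continuous_intros continuous)
  have der: "(\<mu> has_real_derivative g t * \<mu> t) (at t within {0..})" if "t \<ge> 0" for t
  proof -
    have pow: "((\<lambda>t. u t ^ (p + 2)) has_real_derivative real (p + 2) * (D * u t ^ (p + 1))) (at t within {0..})"
      if "(u has_real_derivative D) (at t within {0..})" for u D
      using DERIV_power[OF that, of "p + 2"] by simp
    have *: "((\<lambda>t. c * x t ^ (p + 2) + (1 - c) * y t ^ (p + 2) - v) has_real_derivative
       c * (real (p + 2) * (- (x t ^ (p + 1) * \<mu> t) * x t ^ (p + 1)))
       + (1 - c) * (real (p + 2) * (- (y t ^ (p + 1) * \<mu> t) * y t ^ (p + 1)))) (at t within {0..})"
      using DERIV_diff[OF DERIV_add[OF DERIV_cmult[OF pow[OF dx[OF that]], of c]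
          DERIV_cmult[OF pow[OF dy[OF that]], of "1 - c"]] DERIV_const[of v]] by simp
    have sq: "u ^ (2 * p + 2) = u ^ (p + 1) * u ^ (p + 1)" for u :: real
      by (simp flip: power_add add: mult_2)
    have "\<mu> = (\<lambda>t. c * x t ^ (p + 2) + (1 - c) * y t ^ (p + 2) - v)"
      using \<mu> by auto
    moreover have "c * (real (p + 2) * (- (x t ^ (p + 1) * \<mu> t) * x t ^ (p + 1)))
       + (1 - c) * (real (p + 2) * (- (y t ^ (p + 1) * \<mu> t) * y t ^ (p + 1))) = g t * \<mu> t"
      unfolding g_def sq by (simp add: algebra_simps)
    ultimately show ?thesis
      using * by simp
  qed
  show "\<mu> t \<ge> 0" if "\<mu> 0 \<ge> 0"
    using linear_ode_pos[OF der g, of t] linear_ode_zero[OF der g, of t] assms that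
    by (cases "\<mu> 0 = 0") auto
  show "\<mu> t < 0" if "\<mu> 0 < 0"
    using linear_ode_pos[of "\<lambda>t. - \<mu> t" g t] g assms that der
    by (auto intro: DERIV_minus[of \<mu> "g _ * \<mu> _", simplified])
qed

text \<open>The constant sign of the residual makes \<open>x\<close> and \<open>y\<close> monotone.
  If it is nonnegative they decrease and are bounded below by 0; if it is negative they increase,
  and \<open>v\<close> bounds the weighted sum of powers from above.\<close>

lemma limits:
  obtains a b where "(x \<longlongrightarrow> a) at_top" "(y \<longlongrightarrow> b) at_top" "a > 0"
proof (cases "\<mu> 0 \<ge> 0")
  case True
  have "x t \<le> x s" "y t \<le> y s" if st: "0 \<le> s" "s \<le> t" for s t
  proof -
    have "0 \<le> \<mu> r" "0 \<le> x r" "0 \<le> y r" if "s \<le> r" for r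
      using True sign_persists(1)[of r] pos[of r] that st by (auto intro: less_imp_le)
    then show "x t \<le> x s" "y t \<le> y s"
      using st by (auto intro!: nonincreasing_within[OF dx] nonincreasing_within[OF dy]
          mult_nonneg_nonneg zero_le_power)
  qed
  moreover have "x t > 0" "y t > 0" if "t \<ge> 0" for t
    using pos[OF that] by auto
  ultimately obtain a b where ab: "(x \<longlongrightarrow> a) at_top" "(y \<longlongrightarrow> b) at_top"
    using nonincreasing_convergent[of x 0] nonincreasing_convergent[of y 0] by (metis less_imp_le)
  \<comment> \<open>Since \<open>y t < x t\<close>, a weighted mean of the two powers that is at
    least \<open>v\<close> forces the larger power to be at least \<open>v\<close>. This keeps the
    limit of the decreasing \<open>x\<close> away from 0.\<close>
  have "v \<le> x t ^ (p + 2)" if t: "t \<ge> 0" for t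
  proof -
    have "v \<le> c * x t ^ (p + 2) + (1 - c) * y t ^ (p + 2)"
      using sign_persists(1)[OF t True] \<mu>[of t] by simp
    also have "\<dots> \<le> c * x t ^ (p + 2) + (1 - c) * x t ^ (p + 2)"
      using pos[OF t] y_less_x[OF t] c by (intro add_mono mult_left_mono power_mono) auto
    finally show ?thesis
      by (simp add: algebra_simps)
  qed
  then have "v \<le> a ^ (p + 2)"
    by (intro tendsto_lowerbound[OF tendsto_power[OF ab(1)]])
      (auto simp: eventually_at_top_linorder)
  moreover have "a \<ge> 0"
    using eventually_nonneg by (intro tendsto_lowerbound[OF ab(1)]) auto
  ultimately have "a > 0"
    using v by (cases "a = 0") auto
  with ab show ?thesis
    by (rule that)
next
  case False
  have mono: "x s \<le> x t" "y s \<le> y t" if st: "0 \<le> s" "s \<le> t" for s t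
  proof -
    have neg: "\<mu> r \<le> 0" "0 \<le> x r" "0 \<le> y r" if "s \<le> r" for r
      using False sign_persists(2)[of r] pos[of r] that st by (auto intro: less_imp_le)
    have "- x t \<le> - x s"
      by (rule nonincreasing_within[of "\<lambda>t. - x t" "\<lambda>t. x t ^ (p + 1) * \<mu> t"])
        (use st neg dx in \<open>auto intro!: derivative_eq_intros mult_nonneg_nonpos\<close>)
    moreover have "- y t \<le> - y s"
      by (rule nonincreasing_within[of "\<lambda>t. - y t" "\<lambda>t. y t ^ (p + 1) * \<mu> t"])
        (use st neg dy in \<open>auto intro!: derivative_eq_intros mult_nonneg_nonpos\<close>)
    ultimately show "x s \<le> x t" "y s \<le> y t"
      by auto
  qed
  \<comment> \<open>Above 1 a number is at most its power \<open>p + 2\<close>, so the bound on the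
    power gives one on \<open>x\<close> without taking roots.\<close>
  have bound: "x t \<le> max 1 (v / c)" if t: "t \<ge> 0" for t
  proof (cases "x t \<le> 1")
    case False
    have "c * x t ^ 1 \<le> c * x t ^ (p + 2)"
      using False c by (intro mult_left_mono power_increasing) auto
    also have "\<dots> \<le> c * x t ^ (p + 2) + (1 - c) * y t ^ (p + 2)"
      using pos[OF t] c by simp
    also have "\<dots> \<le> v"
      using sign_persists(2)[OF t] \<mu>[of t] \<open>\<not> 0 \<le> \<mu> 0\<close> by simp
    finally have "x t \<le> v / c"
      using c by (simp add: field_simps)
    then show ?thesis
      by simp
  qed simp
  have "y t \<le> max 1 (v / c)" if t: "t \<ge> 0" for t
    using bound[OF t] y_less_x[OF t] by simp
  with mono bound obtain a b where ab: "(x \<longlongrightarrow> a) at_top" "(y \<longlongrightarrow> b) at_top"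
    using nondecreasing_convergent[of x] nondecreasing_convergent[of y] by metis
  have "x 0 \<le> a"
    using mono by (intro tendsto_lowerbound[OF ab(1)]) (auto simp: eventually_at_top_linorder)
  then have "a > 0"
    using init by simp
  with ab show ?thesis
    by (rule that)
qed

lemma limit_values:
  obtains a b where "(x \<longlongrightarrow> a) at_top" "(y \<longlongrightarrow> b) at_top"
    "a > 0" "b \<ge> 0" "c * a ^ (p + 2) + (1 - c) * b ^ (p + 2) = v"
    "b ^ p * (1 / y 0 ^ p - 1 / x 0 ^ p) \<le> 1"
proof -
  obtain a b where ab: "(x \<longlongrightarrow> a) at_top" "(y \<longlongrightarrow> b) at_top" "a > 0"
    by (rule limits)
  \<comment> \<open>The derivative of the convergent \<open>x\<close> also converges, so its limit
    is 0. As \<open>a > 0\<close>, the power of \<open>a\<close> cancels and the limiting residual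
    vanishes.\<close>
  have "((\<lambda>t. - (x t ^ (p + 1) * \<mu> t)) \<longlongrightarrow>
      - (a ^ (p + 1) * (c * a ^ (p + 2) + (1 - c) * b ^ (p + 2) - v))) at_top"
    unfolding \<mu> by (intro tendsto_intros ab)
  from derivative_limit_zero[OF dx ab(1) this]
  have "c * a ^ (p + 2) + (1 - c) * b ^ (p + 2) = v"
    using ab(3) by simp
  moreover have "b \<ge> 0"
    using eventually_nonneg by (intro tendsto_lowerbound[OF ab(2)]) auto
  \<comment> \<open>With the conserved quantity evaluated at time \<open>t\<close>, the product
    equals \<open>1 - y t ^ p / x t ^ p\<close>.\<close>
  moreover have "y t ^ p * (1 / y 0 ^ p - 1 / x 0 ^ p) \<le> 1" if t: "t \<ge> 0" for t
    unfolding conserved[OF t, symmetric] using pos[OF t] by (simp add: right_diff_distrib)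
  then have "b ^ p * (1 / y 0 ^ p - 1 / x 0 ^ p) \<le> 1"
    by (intro tendsto_upperbound[OF tendsto_mult_right[OF tendsto_power[OF ab(2)]]])
      (auto simp: eventually_at_top_linorder)
  ultimately show ?thesis
    using ab by (intro that)
qed

end

section \<open>The gradient of the loss\<close>

lemma gronwall_system:
  fixes E E' :: "'i \<Rightarrow> real \<Rightarrow> 'a::real_inner"
  assumes I: "finite I"
    and der: "\<And>i t. i \<in> I \<Longrightarrow> t \<ge> 0 \<Longrightarrow> (E i has_vector_derivative E' i t) (at t within {0..})"
    and init: "\<And>i. i \<in> I \<Longrightarrow> E i 0 = 0"
    and T: "T \<ge> 0"
    and bound: "\<And>i t. i \<in> I \<Longrightarrow> 0 \<le> t \<Longrightarrow> t \<le> T \<Longrightarrow> norm (E' i t) \<le> K * L2_set (\<lambda>j. norm (E j t)) I"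
    and i: "i \<in> I"
  shows "E i T = 0"
proof -
  define e where "e t = L2_set (\<lambda>j. norm (E j t)) I" for t
  define u where "u t = (\<Sum>j\<in>I. inner (E j t) (E j t))" for t
  have u: "u t = (e t)\<^sup>2" for t
    by (simp add: u_def e_def L2_set_def sum_nonneg dot_square_norm)
  \<comment> \<open>Each of the \<open>card I\<close> terms is bounded by \<open>K\<close> times the
    whole sum of squares; the 2 comes from differentiating a square.\<close>
  have "u T \<le> u 0 * exp (2 * real (card I) * K * T)"
  proof (rule gronwall_within[of u "\<lambda>t. \<Sum>j\<in>I. 2 * inner (E j t) (E' j t)"])
    fix t :: real assume "t \<ge> 0"
    have "((\<lambda>t. inner (E j t) (E j t)) has_real_derivative 2 * inner (E j t) (E' j t)) (at t within {0..})"
      if "j \<in> I" for j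
    proof -
      note d = der[OF that \<open>t \<ge> 0\<close>, unfolded has_vector_derivative_def]
      show ?thesis
        unfolding has_field_derivative_def
        by (rule has_derivative_eq_rhs[OF has_derivative_inner[OF d d]])
          (auto simp: inner_commute algebra_simps)
    qed
    then show "(u has_real_derivative (\<Sum>j\<in>I. 2 * inner (E j t) (E' j t))) (at t within {0..})"
      unfolding u_def by (intro DERIV_sum) auto
  next
    fix t assume t: "0 \<le> t" "t \<le> T"
    have "inner (E j t) (E' j t) \<le> K * u t" if "j \<in> I" for j
    proof -
      have "inner (E j t) (E' j t) \<le> norm (E j t) * norm (E' j t)"
        by (rule norm_cauchy_schwarz)
      also have "\<dots> \<le> e t * (K * e t)"
        unfolding e_def using that t I
        by (intro mult_mono bound member_le_L2_set[of I j "\<lambda>j. norm (E j t)"] L2_set_nonneg) auto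
      finally show ?thesis
        by (simp add: u power2_eq_square mult_ac)
    qed
    then have "(\<Sum>j\<in>I. inner (E j t) (E' j t)) \<le> (\<Sum>j\<in>I. K * u t)"
      by (rule sum_mono)
    then show "(\<Sum>j\<in>I. 2 * inner (E j t) (E' j t)) \<le> 2 * real (card I) * K * u t"
      by (simp add: sum_distrib_left[symmetric] mult_ac)
  qed (rule T)
  then have "u T \<le> 0"
    by (simp add: u_def init)
  then have "e T = 0"
    by (simp add: u)
  then show ?thesis
    using I i by (simp add: e_def L2_set_eq_0_iff)
qed

text \<open>One constant \<open>K\<close> for the bounds and the distance keeps the relation stable under bounded
  linear and bilinear maps, which gives the Lipschitz estimate for the gradient.\<close>

definition close_along ::
    "real \<Rightarrow> (real \<Rightarrow> real) \<Rightarrow> (real \<Rightarrow> 'a::real_normed_vector) \<Rightarrow> (real \<Rightarrow> 'a) \<Rightarrow> bool" where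
  "close_along T e f g \<longleftrightarrow>
     (\<exists>K\<ge>0. \<forall>t\<in>{0..T}. norm (f t) \<le> K \<and> norm (g t) \<le> K \<and> norm (f t - g t) \<le> K * e t)"

lemma close_along_const:
  assumes "\<And>t. e t \<ge> 0"
  shows "close_along T e (\<lambda>t. c) (\<lambda>t. c)"
  unfolding close_along_def by (rule exI[of _ "norm c"]) (use assms in auto)

lemma close_along_bounded_linear:
  assumes h: "bounded_linear h" and "close_along T e f g"
  shows "close_along T e (\<lambda>t. h (f t)) (\<lambda>t. h (g t))"
proof -
  interpret bounded_linear h by (rule h)
  obtain B where B: "B \<ge> 0" "\<And>x. norm (h x) \<le> norm x * B"
    using nonneg_bounded by blast
  obtain K where K: "K \<ge> 0" "\<And>t. t \<in> {0..T} \<Longrightarrow>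
      norm (f t) \<le> K \<and> norm (g t) \<le> K \<and> norm (f t - g t) \<le> K * e t"
    using assms(2) unfolding close_along_def by blast
  have "norm (h (f t)) \<le> K * B \<and> norm (h (g t)) \<le> K * B \<and> norm (h (f t) - h (g t)) \<le> K * B * e t"
    if t: "t \<in> {0..T}" for t
  proof -
    have "norm (h x) \<le> C * B" if "norm x \<le> C" for x and C
      using B(2)[of x] mult_right_mono[OF that B(1)] by linarith
    from this[of "f t" K] this[of "g t" K] this[of "f t - g t" "K * e t"] show ?thesis
      using K(2)[OF t] by (simp add: diff mult_ac)
  qed
  then show ?thesis
    unfolding close_along_def using K(1) B(1) by (intro exI[of _ "K * B"]) auto
qed

lemma close_along_bounded_bilinear:
  assumes h: "bounded_bilinear h" and "close_along T e f f'" "close_along T e g g'"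
  shows "close_along T e (\<lambda>t. h (f t) (g t)) (\<lambda>t. h (f' t) (g' t))"
proof -
  interpret bounded_bilinear h by (rule h)
  obtain B where B: "B \<ge> 0" "\<And>x y. norm (h x y) \<le> norm x * norm y * B"
    using nonneg_bounded by blast
  obtain K where K: "K \<ge> 0" "\<And>t. t \<in> {0..T} \<Longrightarrow>
      norm (f t) \<le> K \<and> norm (f' t) \<le> K \<and> norm (f t - f' t) \<le> K * e t"
    using assms(2) unfolding close_along_def by blast
  obtain M where M: "M \<ge> 0" "\<And>t. t \<in> {0..T} \<Longrightarrow>
      norm (g t) \<le> M \<and> norm (g' t) \<le> M \<and> norm (g t - g' t) \<le> M * e t"
    using assms(3) unfolding close_along_def by blast
  have bd: "norm (h x y) \<le> C * D * B" if "norm x \<le> C" "norm y \<le> D" for x y C D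
  proof -
    have "C \<ge> 0" using that norm_ge_zero order_trans by blast
    with that B(1) have "norm x * norm y * B \<le> C * D * B"
      by (intro mult_right_mono mult_mono) auto
    with B(2) show ?thesis
      by (rule order_trans)
  qed
  \<comment> \<open>The difference of the two values splits into two terms, each changing one
    argument and each bounded by \<open>K * M * B * e t\<close>.\<close>
  define C where "C = 2 * (K * M * B)"
  have "norm (h (f t) (g t)) \<le> C \<and> norm (h (f' t) (g' t)) \<le> C
      \<and> norm (h (f t) (g t) - h (f' t) (g' t)) \<le> C * e t" if t: "t \<in> {0..T}" for t
  proof -
    note Kt = K(2)[OF t] and Mt = M(2)[OF t]
    have "K * M * B \<le> C"
      using K(1) M(1) B(1) by (simp add: C_def)
    moreover have "h (f t) (g t) - h (f' t) (g' t) = h (f t - f' t) (g t) + h (f' t) (g t - g' t)"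
      by (simp add: diff_left diff_right)
    moreover have "norm (h (f t - f' t) (g t)) \<le> K * e t * M * B"
      "norm (h (f' t) (g t - g' t)) \<le> K * (M * e t) * B"
      using Kt Mt by (auto intro!: bd)
    then have "norm (h (f t - f' t) (g t) + h (f' t) (g t - g' t)) \<le> K * e t * M * B + K * (M * e t) * B"
      by (intro norm_triangle_mono)
    ultimately show ?thesis
      using bd[of "f t" K "g t" M] bd[of "f' t" K "g' t" M] Kt Mt
      by (auto simp: C_def mult_ac)
  qed
  moreover have "C \<ge> 0"
    using K(1) M(1) B(1) by (simp add: C_def)
  ultimately show ?thesis
    unfolding close_along_def by blast
qed

lemma close_along_diff_const:
  assumes e: "\<And>t. e t \<ge> 0" and "close_along T e f g"
  shows "close_along T e (\<lambda>t. f t - c) (\<lambda>t. g t - c)"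
proof -
  obtain K where K: "K \<ge> 0" "\<And>t. t \<in> {0..T} \<Longrightarrow>
      norm (f t) \<le> K \<and> norm (g t) \<le> K \<and> norm (f t - g t) \<le> K * e t"
    using assms(2) unfolding close_along_def by blast
  have "norm (f t - c) \<le> K + norm c \<and> norm (g t - c) \<le> K + norm c
      \<and> norm ((f t - c) - (g t - c)) \<le> (K + norm c) * e t" if t: "t \<in> {0..T}" for t
  proof -
    have "norm (f t - g t) \<le> (K + norm c) * e t"
      using K(2)[OF t] e[of t] by (simp add: distrib_right add_increasing2)
    then show ?thesis
      using K(2)[OF t] norm_triangle_ineq4[of "f t" c] norm_triangle_ineq4[of "g t" c] by auto
  qed
  then show ?thesis
    unfolding close_along_def using K(1) by (intro exI[of _ "K + norm c"]) auto
qed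

section \<open>Frobenius adjoints and the gradient of a masked quadratic loss\<close>

lemma bounded_bilinear_matrix_matrix_mult:
  "bounded_bilinear ((**) :: real ^ 'n ^ 'm \<Rightarrow> real ^ 'k ^ 'n \<Rightarrow> real ^ 'k ^ 'm)"
  unfolding bilinear_conv_bounded_bilinear[symmetric] bilinear_def
  by (auto intro!: linearI simp: matrix_matrix_mult_def vec_eq_iff sum.distrib sum_distrib_left algebra_simps)

lemma bounded_linear_transpose: "bounded_linear (transpose :: real ^ 'n ^ 'm \<Rightarrow> real ^ 'm ^ 'n)"
  unfolding linear_conv_bounded_linear[symmetric]
  by (auto intro!: linearI simp: transpose_def vec_eq_iff)

lemma inner_matrix_mult_left:
  fixes A :: "real ^ 'n ^ 'm"
  shows "inner (A ** H) C = inner H (transpose A ** C)"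
proof -
  have "inner (A ** H) C = (\<Sum>i\<in>UNIV. \<Sum>j\<in>UNIV. \<Sum>k\<in>UNIV. A $ i $ k * H $ k $ j * C $ i $ j)"
    by (simp add: inner_vec_def matrix_matrix_mult_def sum_distrib_right)
  also have "\<dots> = (\<Sum>i\<in>UNIV. \<Sum>k\<in>UNIV. \<Sum>j\<in>UNIV. A $ i $ k * H $ k $ j * C $ i $ j)"
    by (intro sum.cong refl sum.swap)
  also have "\<dots> = (\<Sum>k\<in>UNIV. \<Sum>i\<in>UNIV. \<Sum>j\<in>UNIV. A $ i $ k * H $ k $ j * C $ i $ j)"
    by (rule sum.swap)
  also have "\<dots> = (\<Sum>k\<in>UNIV. \<Sum>j\<in>UNIV. \<Sum>i\<in>UNIV. A $ i $ k * H $ k $ j * C $ i $ j)"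
    by (intro sum.cong refl sum.swap)
  also have "\<dots> = inner H (transpose A ** C)"
    by (simp add: inner_vec_def matrix_matrix_mult_def transpose_def sum_distrib_left mult_ac)
  finally show ?thesis .
qed

lemma inner_transpose:
  fixes A :: "real ^ 'n ^ 'm"
  shows "inner (transpose A) (transpose B) = inner A B"
  unfolding inner_vec_def transpose_def by (simp, rule sum.swap)

lemma inner_matrix_mult_right:
  fixes A :: "real ^ 'n ^ 'm"
  shows "inner (H ** A) C = inner H (C ** transpose A)"
proof -
  have "inner (H ** A) C = inner (transpose A ** transpose H) (transpose C)"
    by (metis inner_transpose matrix_transpose_mul)
  also have "\<dots> = inner (transpose H) (transpose (C ** transpose A))"
    by (simp add: inner_matrix_mult_left matrix_transpose_mul)
  finally show ?thesis
    by (simp add: inner_transpose)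
qed

text \<open>This is the orthogonal projection onto the matrices supported on \<open>S\<close>; it
  turns the sum over observed entries into a squared Frobenius norm.\<close>

definition mask :: "('m \<times> 'n) set \<Rightarrow> real ^ 'n ^ 'm \<Rightarrow> real ^ 'n ^ 'm" where
  "mask S X = (\<chi> i j. if (i, j) \<in> S then X $ i $ j else 0)"

lemma bounded_linear_mask: "bounded_linear (mask S :: real ^ 'n ^ 'm \<Rightarrow> _)"
  unfolding linear_conv_bounded_linear[symmetric]
  by (auto intro!: linearI simp: mask_def vec_eq_iff)

lemma inner_mask: "inner (mask S X) (mask S Y) = inner X (mask S Y)"
  unfolding inner_vec_def mask_def by (auto intro!: sum.cong)

lemma sum_squares_eq_inner_mask:
  fixes X :: "real ^ 'n ^ 'm"
  shows "(\<Sum>(i, j)\<in>S. (X $ i $ j - w)\<^sup>2) = inner (mask S (X - (\<chi> i j. w))) (mask S (X - (\<chi> i j. w)))"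
proof -
  have "inner (mask S (X - (\<chi> i j. w))) (mask S (X - (\<chi> i j. w)))
      = (\<Sum>i\<in>UNIV. \<Sum>j\<in>UNIV. if (i, j) \<in> S then (X $ i $ j - w)\<^sup>2 else 0)"
    unfolding inner_vec_def mask_def by (auto intro!: sum.cong simp: power2_eq_square)
  also have "\<dots> = (\<Sum>(i, j)\<in>UNIV \<times> UNIV. if (i, j) \<in> S then (X $ i $ j - w)\<^sup>2 else 0)"
    by (rule sum.cartesian_product)
  also have "\<dots> = (\<Sum>(i, j)\<in>S. (X $ i $ j - w)\<^sup>2)"
    by (rule sum.mono_neutral_cong_right) auto
  finally show ?thesis ..
qed

text \<open>The loss is half the squared norm of the affine map \<open>R\<close>. Its gradient is
  the adjoint of the linear part applied to the residual, and the mask is absorbed because it is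
  self-adjoint and idempotent.\<close>

lemma gderiv_masked_loss:
  fixes A :: "real ^ 'n ^ 'm" and C :: "real ^ 'l ^ 'k" and w :: real and S :: "('m \<times> 'l) set"
  defines "R \<equiv> \<lambda>X. mask S (A ** X ** C - (\<chi> i j. w))"
  shows "GDERIV (\<lambda>X. 1 / 2 * (\<Sum>(i, j)\<in>S. ((A ** X ** C) $ i $ j - w)\<^sup>2)) X :>
    transpose A ** R X ** transpose C"
proof -
  have lin: "bounded_linear (\<lambda>X. mask S (A ** X ** C))"
    by (rule bounded_linear_compose[OF bounded_linear_mask
          bounded_linear_compose[OF
            bounded_bilinear.bounded_linear_left[OF bounded_bilinear_matrix_matrix_mult, of C]
            bounded_bilinear.bounded_linear_right[OF bounded_bilinear_matrix_matrix_mult, of A]]])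
  have "R = (\<lambda>X. mask S (A ** X ** C) - mask S (\<chi> i j. w))"
    unfolding R_def by (auto simp: linear_diff[OF bounded_linear.linear[OF bounded_linear_mask]])
  then have R: "(R has_derivative (\<lambda>H. mask S (A ** H ** C))) (at X)"
    using has_derivative_diff[OF bounded_linear_imp_has_derivative[OF lin] has_derivative_const] by simp
  have "((\<lambda>X. 1 / 2 * inner (R X) (R X)) has_derivative
      (\<lambda>H. 1 / 2 * (inner (R X) (mask S (A ** H ** C)) + inner (mask S (A ** H ** C)) (R X)))) (at X)"
    by (intro has_derivative_mult_right has_derivative_inner R)
  moreover have "inner (mask S (A ** H ** C)) (R X) = inner H (transpose A ** R X ** transpose C)" for H
    unfolding R_def
    by (subst inner_mask, subst inner_matrix_mult_right, subst inner_matrix_mult_left)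
      (simp only: matrix_mul_assoc)
  moreover have "(\<Sum>(i, j)\<in>S. ((A ** X ** C) $ i $ j - w)\<^sup>2) = inner (R X) (R X)" for X
    unfolding R_def by (rule sum_squares_eq_inner_mask)
  ultimately show ?thesis
    unfolding gderiv_def by (simp add: inner_commute[of "R X"])
qed

text \<open>\<open>gradient_flow\<close> only asserts that some gradient exists; uniqueness
  identifies it with the explicit formula.\<close>

lemma GDERIV_unique:
  assumes "GDERIV f x :> D" "GDERIV f x :> D'"
  shows "D = D'"
proof -
  have "(\<lambda>h. inner h D) = (\<lambda>h. inner h D')"
    using assms unfolding gderiv_def by (rule has_derivative_unique)
  then show ?thesis
    by (metis vector_eq_ldot)
qed

section \<open>Products of layers and the partial gradients of the loss\<close>

lemma layer_prod_cong:
  assumes "\<And>l. l \<in> {1..k} \<Longrightarrow> W l = V l"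
  shows "layer_prod W k = layer_prod V k"
  using assms by (induction k) auto

lemma layer_prod_add: "layer_prod W (a + b) = layer_prod (\<lambda>k. W (k + a)) b ** layer_prod W a"
  by (induction b) (auto simp: matrix_mul_assoc add.commute)

text \<open>Isolating layer \<open>l\<close> shows that the product is linear in it. Since
  \<open>layer_prod\<close> starts at index 1, the layers above \<open>l\<close> are reindexed by
  \<open>k + l\<close>.\<close>

lemma layer_prod_update:
  assumes "l \<in> {1..L}"
  shows "layer_prod (W(l := X)) L =
    layer_prod (\<lambda>k. W (k + l)) (L - l) ** X ** layer_prod W (l - 1)"
proof -
  have "layer_prod (W(l := X)) L = layer_prod (W(l := X)) (l + (L - l))"
    using assms by simp
  also have "\<dots> = layer_prod (\<lambda>k. (W(l := X)) (k + l)) (L - l) ** layer_prod (W(l := X)) (Suc (l - 1))"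
    using assms by (subst layer_prod_add) simp
  also have "layer_prod (W(l := X)) (Suc (l - 1)) = X ** layer_prod (W(l := X)) (l - 1)"
    unfolding layer_prod.simps using assms by simp
  also have "layer_prod (W(l := X)) (l - 1) = layer_prod W (l - 1)"
    using assms by (intro layer_prod_cong) auto
  also have "layer_prod (\<lambda>k. (W(l := X)) (k + l)) (L - l) = layer_prod (\<lambda>k. W (k + l)) (L - l)"
    by (intro layer_prod_cong) auto
  finally show ?thesis
    by (simp only: matrix_mul_assoc)
qed

definition loss_grad ::
    "('d \<times> 'd) set \<Rightarrow> real \<Rightarrow> nat \<Rightarrow> (nat \<Rightarrow> real ^ 'd ^ 'd) \<Rightarrow> nat \<Rightarrow> real ^ 'd ^ 'd" where
  "loss_grad S w L W l = transpose (layer_prod (\<lambda>k. W (k + l)) (L - l))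
     ** mask S (layer_prod W L - (\<chi> i j. w)) ** transpose (layer_prod W (l - 1))"

lemma GDERIV_block_loss:
  assumes "l \<in> {1..L}"
  shows "GDERIV (\<lambda>X. block_loss idx s n w L (W(l := X))) (W l) :>
    loss_grad (Omega_block idx s n) w L W l"
proof -
  define A where "A = layer_prod (\<lambda>k. W (k + l)) (L - l)"
  define C where "C = layer_prod W (l - 1)"
  have upd: "layer_prod (W(l := X)) L = A ** X ** C" for X
    unfolding A_def C_def by (rule layer_prod_update[OF assms])
  from upd[of "W l"] have "layer_prod W L = A ** W l ** C"
    by (simp only: fun_upd_triv)
  then show ?thesis
    unfolding block_loss_def upd loss_grad_def A_def[symmetric] C_def[symmetric]
    by (simp only:) (rule gderiv_masked_loss)
qed

lemma gradient_flow_block_loss: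
  assumes "gradient_flow (block_loss idx s n w L) L W" "l \<in> {1..L}" "t \<ge> 0"
  shows "(W l has_vector_derivative - loss_grad (Omega_block idx s n) w L (\<lambda>k. W k t) l)
    (at t within {0..})"
proof -
  obtain G where "GDERIV (\<lambda>X. block_loss idx s n w L ((\<lambda>k. W k t)(l := X))) (W l t) :> G"
    "(W l has_vector_derivative - G) (at t within {0..})"
    using assms unfolding gradient_flow_def by meson
  with GDERIV_unique[OF this(1) GDERIV_block_loss[OF assms(2), of idx s n w "\<lambda>k. W k t"]]
  show ?thesis
    by simp
qed

lemma close_along_layer_prod:
  assumes "\<And>t. e t \<ge> 0" "\<And>l. l \<in> {1..k} \<Longrightarrow> close_along T e (W l) (V l)"
  shows "close_along T e (\<lambda>t. layer_prod (\<lambda>l. W l t) k) (\<lambda>t. layer_prod (\<lambda>l. V l t) k)"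
  using assms(2)
proof (induction k)
  case 0
  show ?case
    by (simp add: close_along_const assms)
next
  case (Suc k)
  have "close_along T e (\<lambda>t. W (Suc k) t ** layer_prod (\<lambda>l. W l t) k)
      (\<lambda>t. V (Suc k) t ** layer_prod (\<lambda>l. V l t) k)"
    by (rule close_along_bounded_bilinear[OF bounded_bilinear_matrix_matrix_mult])
      (use Suc in auto)
  then show ?case
    by simp
qed

text \<open>The gradient is built from matrix products, transposition, masking and subtraction of a
  constant, all of which preserve \<open>close_along\<close>.\<close>

lemma close_along_loss_grad:
  assumes "\<And>t. e t \<ge> 0" "\<And>l. l \<in> {1..L} \<Longrightarrow> close_along T e (W l) (V l)" "l \<in> {1..L}"
  shows "close_along T e (\<lambda>t. loss_grad S w L (\<lambda>l. W l t) l) (\<lambda>t. loss_grad S w L (\<lambda>l. V l t) l)"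
proof -
  have "close_along T e (\<lambda>t. layer_prod (\<lambda>k. W (k + l) t) (L - l)) (\<lambda>t. layer_prod (\<lambda>k. V (k + l) t) (L - l))"
    "close_along T e (\<lambda>t. layer_prod (\<lambda>l. W l t) L) (\<lambda>t. layer_prod (\<lambda>l. V l t) L)"
    "close_along T e (\<lambda>t. layer_prod (\<lambda>l. W l t) (l - 1)) (\<lambda>t. layer_prod (\<lambda>l. V l t) (l - 1))"
    using assms(2,3) by (auto intro!: close_along_layer_prod assms(1))
  then show ?thesis
    unfolding loss_grad_def
    by (intro close_along_bounded_bilinear[OF bounded_bilinear_matrix_matrix_mult]
      close_along_bounded_linear[OF bounded_linear_transpose]
      close_along_bounded_linear[OF bounded_linear_mask]
      close_along_diff_const[OF assms(1)])
qed

section \<open>The algebra of block-symmetric matrices\<close>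

locale block_indexing =
  fixes idx :: "'d::finite \<Rightarrow> nat" and s n :: nat
  assumes idx: "bij_betw idx UNIV {1..s * n}" and s: "s \<ge> 1" and n: "n \<ge> 2"
begin

text \<open>Blocks are numbered from 0 here and from 1 in \<open>Omega_block\<close>, which accounts
  for the shifts by one below.\<close>

definition blk :: "'d \<Rightarrow> nat" where
  "blk i = (idx i - 1) div s"

lemma idx_range: "1 \<le> idx i" "idx i \<le> s * n"
  using bij_betwE[OF idx] by auto

lemma block_iff:
  assumes "b \<ge> 1"
  shows "idx i \<in> {(b - 1) * s + 1..b * s} \<longleftrightarrow> blk i = b - 1"
proof -
  obtain c where c: "b = Suc c"
    using assms by (cases b) auto
  obtain k where k: "idx i = Suc k"
    using idx_range(1)[of i] by (cases "idx i") auto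
  have "idx i \<in> {(b - 1) * s + 1..b * s} \<longleftrightarrow> c * s \<le> k \<and> k < Suc c * s"
    unfolding c k by auto
  also have "\<dots> \<longleftrightarrow> k div s = c"
  proof
    assume "c * s \<le> k \<and> k < Suc c * s"
    then show "k div s = c"
      by (intro div_nat_eqI) (auto simp: mult.commute)
  next
    assume "k div s = c"
    then show "c * s \<le> k \<and> k < Suc c * s"
      using s div_times_less_eq_dividend[of k s] dividend_less_div_times[of s k] by auto
  qed
  finally show ?thesis
    by (simp add: blk_def c k)
qed

lemma blk_less: "blk i < n"
  unfolding blk_def using idx_range[of i] s
  by (intro less_mult_imp_div_less) (simp add: mult.commute)

lemma mem_Omega_block_iff: "(i, j) \<in> Omega_block idx s n \<longleftrightarrow> blk i = blk j"
proof
  assume "(i, j) \<in> Omega_block idx s n"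
  then obtain b where "b \<in> {1..n}" "idx i \<in> {(b - 1) * s + 1..b * s}" "idx j \<in> {(b - 1) * s + 1..b * s}"
    unfolding Omega_block_def by blast
  then show "blk i = blk j"
    using block_iff[of b i] block_iff[of b j] by simp
next
  assume "blk i = blk j"
  then have "idx i \<in> {(Suc (blk i) - 1) * s + 1..Suc (blk i) * s}"
    "idx j \<in> {(Suc (blk i) - 1) * s + 1..Suc (blk i) * s}"
    using block_iff[of "Suc (blk i)" i] block_iff[of "Suc (blk i)" j] by auto
  moreover have "Suc (blk i) \<in> {1..n}"
    using blk_less[of i] by auto
  ultimately show "(i, j) \<in> Omega_block idx s n"
    unfolding Omega_block_def by blast
qed

lemma card_index: "CARD('d) = s * n"
  using bij_betw_same_card[OF idx] by simp

lemma card_block: "card {k. blk k = blk i} = s"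
proof -
  let ?b = "Suc (blk i)"
  have "idx ` {k. blk k = blk i} = {(?b - 1) * s + 1..?b * s}"
  proof (intro equalityI subsetI)
    fix q assume "q \<in> idx ` {k. blk k = blk i}"
    then show "q \<in> {(?b - 1) * s + 1..?b * s}"
      using block_iff[of ?b] by auto
  next
    fix q assume q: "q \<in> {(?b - 1) * s + 1..?b * s}"
    have "?b * s \<le> n * s"
      using blk_less[of i] by (intro mult_le_mono1) simp
    with q have "q \<in> {1..s * n}"
      by (auto simp: mult.commute)
    then obtain k where "q = idx k"
      using idx unfolding bij_betw_def by blast
    with q show "q \<in> idx ` {k. blk k = blk i}"
      using block_iff[of ?b k] by auto
  qed
  moreover have "inj_on idx {k. blk k = blk i}"
    using idx by (auto simp: bij_betw_def intro: inj_on_subset)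
  ultimately have "card {k. blk k = blk i} = card {(?b - 1) * s + 1..?b * s}"
    by (metis card_image)
  then show ?thesis
    by simp
qed

definition ones :: "real ^ 'd ^ 'd" where
  "ones = (\<chi> i j. 1)"

definition blocks :: "real ^ 'd ^ 'd" where
  "blocks = (\<chi> i j. if blk i = blk j then 1 else 0)"

text \<open>The symmetric matrix with eigenvalue \<open>x\<close> on the constant vectors, \<open>y\<close> on the vectors
  that are constant on blocks and have sum zero, and \<open>z\<close> on the vectors with sum zero in each
  block; the last eigenspace is trivial for \<open>s = 1\<close>.\<close>

definition spec :: "real \<Rightarrow> real \<Rightarrow> real \<Rightarrow> real ^ 'd ^ 'd" where
  "spec x y z = ((x - y) / (s * n)) *\<^sub>R ones + ((y - z) / s) *\<^sub>R blocks + z *\<^sub>R mat 1"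

lemma sum_block: "(\<Sum>k\<in>UNIV. if blk i = blk k then c else 0) = s * (c::real)"
proof -
  have "{k \<in> UNIV. blk i = blk k} = {k. blk k = blk i}"
    by auto
  then show ?thesis
    using card_block[of i] by (simp add: sum.If_cases Int_def)
qed

lemma ones_ones: "ones ** ones = (s * n) *\<^sub>R ones"
  by (simp add: ones_def matrix_matrix_mult_def vec_eq_iff card_index)

lemma blocks_ones: "blocks ** ones = s *\<^sub>R ones"
  by (simp add: ones_def blocks_def matrix_matrix_mult_def vec_eq_iff sum_block)

lemma ones_blocks: "ones ** blocks = s *\<^sub>R ones"
  using sum_block[where c = 1]
  by (simp add: ones_def blocks_def matrix_matrix_mult_def vec_eq_iff eq_commute[of "blk _" "blk _"])

lemma blocks_blocks: "blocks ** blocks = s *\<^sub>R blocks"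
proof -
  have "(\<Sum>k\<in>UNIV. (if blk i = blk k then 1 else 0) * (if blk k = blk j then 1 else 0))
      = (if blk i = blk j then s else 0 :: real)" for i j
  proof (cases "blk i = blk j")
    case True
    then have "(\<Sum>k\<in>UNIV. (if blk i = blk k then 1 else 0) * (if blk k = blk j then 1 else 0 :: real))
        = (\<Sum>k\<in>UNIV. if blk i = blk k then 1 else 0)"
      by (intro sum.cong) auto
    then show ?thesis
      using True sum_block[of i 1] by simp
  next
    case False
    then show ?thesis
      by (auto intro!: sum.neutral)
  qed
  then show ?thesis
    by (simp add: blocks_def matrix_matrix_mult_def vec_eq_iff)
qed

text \<open>The matrices share their eigenspaces, so eigenvalues multiply separately. The
  calculation compares the coefficients of \<open>ones\<close>, \<open>blocks\<close> and
  \<open>mat 1\<close>.\<close>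

lemma spec_mult: "spec x y z ** spec x' y' z' = spec (x * x') (y * y') (z * z')"
proof -
  interpret bounded_bilinear "(**) :: real ^ 'd ^ 'd \<Rightarrow> real ^ 'd ^ 'd \<Rightarrow> real ^ 'd ^ 'd"
    by (rule bounded_bilinear_matrix_matrix_mult)
  define a b a' b' where ab: "a = (x - y) / (s * n)" "b = (y - z) / s"
    "a' = (x' - y') / (s * n)" "b' = (y' - z') / s"
  have "spec x y z ** spec x' y' z' =
    (a * a' * (s * n) + a * b' * s + a * z' + b * a' * s + z * a') *\<^sub>R ones
    + (b * b' * s + b * z' + z * b') *\<^sub>R blocks + (z * z') *\<^sub>R mat 1"
    unfolding spec_def ab[symmetric]
    by (simp add: add_left add_right scaleR_left scaleR_right ones_ones ones_blocks blocks_ones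
        blocks_blocks algebra_simps)
  moreover have "a * a' * (s * n) + a * b' * s + a * z' + b * a' * s + z * a' = (x * x' - y * y') / (s * n)"
    "b * b' * s + b * z' + z * b' = (y * y' - z * z') / s"
    using s n by (simp_all add: ab field_simps)
  ultimately show ?thesis
    by (simp add: spec_def)
qed

lemma spec_one: "spec 1 1 1 = mat 1"
  by (simp add: spec_def)

lemma transpose_spec: "transpose (spec x y z) = spec x y z"
  by (auto simp: spec_def ones_def blocks_def mat_def transpose_def vec_eq_iff)

lemma spec_add: "spec x y z + spec x' y' z' = spec (x + x') (y + y') (z + z')"
  by (simp add: spec_def vec_eq_iff add_divide_distrib diff_divide_distrib algebra_simps)

lemma spec_scaleR: "c *\<^sub>R spec x y z = spec (c * x) (c * y) (c * z)"
  by (simp add: spec_def scaleR_add_right right_diff_distrib)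

lemma spec_uminus: "- spec x y z = spec (- x) (- y) (- z)"
  using spec_scaleR[of "- 1" x y z] by simp

lemma layer_prod_spec: "layer_prod (\<lambda>l. spec x y z) k = spec (x ^ k) (y ^ k) (z ^ k)"
  by (induction k) (auto simp: spec_one spec_mult)

text \<open>Masking turns \<open>ones\<close> into \<open>blocks\<close> and fixes
  \<open>blocks\<close> and \<open>mat 1\<close>. No multiple of \<open>ones\<close> remains, so the
  first two eigenvalues coincide; this is the origin of the common residual.\<close>

lemma mask_spec:
  fixes w :: real
  shows "mask (Omega_block idx s n) (spec x y z - (\<chi> i j. w)) =
    spec (x / n + (1 - 1 / n) * y - w * s) (x / n + (1 - 1 / n) * y - w * s) z"
proof -
  have "(x - y) / (real s * real n) + (y - z) / s - w = (x / n + (1 - 1 / n) * y - w * s - z) / s"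
    using s n by (simp add: field_simps)
  then show ?thesis
    by (auto simp: mask_def spec_def ones_def blocks_def mat_def vec_eq_iff mem_Omega_block_iff)
qed

text \<open>The layers above and below \<open>l\<close> contribute \<open>L - l\<close> and
  \<open>l - 1\<close> factors, in total \<open>L - 1\<close> for every \<open>l\<close>. Hence all
  layers have the same gradient and equal factors stay equal.\<close>

lemma loss_grad_spec:
  fixes x y z w :: real
  assumes "l \<in> {1..L}"
  defines "\<mu> \<equiv> x ^ L / n + (1 - 1 / n) * y ^ L - w * s"
  shows "loss_grad (Omega_block idx s n) w L (\<lambda>k. spec x y z) l =
    spec (x ^ (L - 1) * \<mu>) (y ^ (L - 1) * \<mu>) (z ^ (2 * L - 1))"
proof -
  have *: "u ^ (L - l) * v * u ^ (l - 1) = u ^ (L - 1) * v" for u v :: real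
    using assms(1) by (simp add: mult.commute mult.left_commute flip: power_add)
  have "z ^ (L - 1) * z ^ L = z ^ (2 * L - 1)"
    using assms(1) by (simp flip: power_add add: mult_2)
  then show ?thesis
    unfolding loss_grad_def layer_prod_spec mask_spec transpose_spec spec_mult \<mu>_def[symmetric] *
    by simp
qed

lemma init_matrix_eq:
  "init_matrix \<alpha> m = spec (\<alpha> - \<alpha> / m + \<alpha> / m * (s * n)) (\<alpha> - \<alpha> / m) (\<alpha> - \<alpha> / m)"
  using s n by (auto simp: spec_def init_matrix_def ones_def blocks_def mat_def vec_eq_iff)

text \<open>The weights \<open>1\<close>, \<open>n - 1\<close> and \<open>n * (s - 1)\<close> are
  the dimensions of the three eigenspaces.\<close>

lemma inner_spec:
  "inner (spec x y z) (spec x' y' z') = x * x' + y * y' * (real n - 1) + z * z' * (n * (real s - 1))"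
proof -
  define a b a' b' where ab: "a = (x - y) / (s * n)" "b = (y - z) / s"
    "a' = (x' - y') / (s * n)" "b' = (y' - z') / s"
  have "inner ones ones = (s * n) * real (s * n)" "inner ones blocks = s * real (s * n)"
    "inner blocks blocks = s * real (s * n)"
    "inner ones (mat 1) = real (s * n)" "inner blocks (mat 1) = real (s * n)"
    "inner (mat 1) (mat 1 :: real ^ 'd ^ 'd) = real (s * n)"
    by (simp_all add: inner_vec_def ones_def blocks_def mat_def card_index sum_block
        if_distrib[of "\<lambda>x. _ * x"] if_distrib[of "\<lambda>x. x * _"] cong: if_cong)
  then have "inner (spec x y z) (spec x' y' z') =
     (a * a' * s * n + a * b' * s + a * z' + b * a' * s + b * b' * s + b * z' + z * a' + z * b' + z * z') * (s * n)"
    unfolding spec_def ab[symmetric]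
    by (simp add: inner_add_left inner_add_right inner_commute[of blocks ones]
        inner_commute[of "mat 1" ones] inner_commute[of "mat 1" blocks] algebra_simps)
  also have "\<dots> = x * x' + y * y' * (real n - 1) + z * z' * (n * (real s - 1))"
    using s n by (simp add: ab field_simps)
  finally show ?thesis .
qed

end

section \<open>Reduction to eigenvalues and the limit\<close>

text \<open>Cauchy-Schwarz row by row; it bounds the spectral norm by the Frobenius norm.\<close>

lemma norm_matrix_vector_mult_le:
  fixes A :: "real ^ 'n ^ 'm"
  shows "norm (A *v v) \<le> norm A * norm v"
proof -
  have "norm (A *v v) = L2_set (\<lambda>i. \<bar>inner (A $ i) v\<bar>) UNIV"
    by (simp add: norm_vec_def matrix_mult_dot)
  also have "\<dots> \<le> L2_set (\<lambda>i. norm (A $ i) * norm v) UNIV"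
    by (intro L2_set_mono Cauchy_Schwarz_ineq2) auto
  also have "\<dots> = norm A * norm v"
    by (simp add: norm_vec_def[where 'a = "real ^ 'n"] L2_set_left_distrib)
  finally show ?thesis .
qed

context block_indexing
begin

text \<open>\<open>spec 1 0 0\<close>, \<open>spec 0 1 0\<close> and \<open>spec 0 0 1\<close> are
  the projectors onto the eigenspaces. Pairing with a projector and dividing by its rank extends the
  eigenvalue linearly to all matrices.\<close>

definition eig1 :: "real ^ 'd ^ 'd \<Rightarrow> real" where
  "eig1 X = inner X (spec 1 0 0)"

definition eig2 :: "real ^ 'd ^ 'd \<Rightarrow> real" where
  "eig2 X = inner X (spec 0 1 0) / (real n - 1)"

text \<open>For \<open>s = 1\<close> the denominator vanishes and \<open>eig3\<close> is zero.\<close>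

definition eig3 :: "real ^ 'd ^ 'd \<Rightarrow> real" where
  "eig3 X = inner X (spec 0 0 1) / (real n * (real s - 1))"

text \<open>This is the orthogonal projection onto the block-symmetric matrices.\<close>

definition proj :: "real ^ 'd ^ 'd \<Rightarrow> real ^ 'd ^ 'd" where
  "proj X = spec (eig1 X) (eig2 X) (eig3 X)"

lemma bounded_linear_eig: "bounded_linear eig1" "bounded_linear eig2" "bounded_linear eig3"
  unfolding linear_conv_bounded_linear[symmetric]
  by (auto intro!: linearI simp: eig1_def eig2_def eig3_def inner_add_left add_divide_distrib)

lemma bounded_linear_proj: "bounded_linear proj"
  using bounded_linear_eig unfolding linear_conv_bounded_linear[symmetric]
  by (auto intro!: linearI simp: proj_def linear_add linear_scale spec_add spec_scaleR)

lemma eig_spec: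
  "eig1 (spec x y z) = x" "eig2 (spec x y z) = y" "eig3 (spec x y z) = (if s = 1 then 0 else z)"
  using s n by (auto simp: eig1_def eig2_def eig3_def inner_spec)

lemma proj_spec: "proj (spec x y z) = spec x y z"
proof (cases "s = 1")
  case True
  \<comment> \<open>For \<open>s = 1\<close> this matrix has norm 0 by \<open>inner_spec\<close>, so
    replacing \<open>z\<close> by the default value 0 of \<open>eig3\<close> changes
    nothing.\<close>
  then have "spec 0 0 z = 0"
    using inner_spec[of 0 0 z 0 0 z] by simp
  then have "spec x y z = spec x y 0"
    using spec_add[of x y 0 0 0 z] by simp
  then show ?thesis
    unfolding proj_def eig_spec if_P[OF True] by (rule sym)
qed (simp add: proj_def eig_spec)

text \<open>Each layer is compared with the projected first layer \<open>P\<close>, so no solution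
  of the reduced system has to be constructed. At the tuple with all layers \<open>P\<close> the
  gradients agree and are fixed by \<open>proj\<close>; they cancel in the derivative of the
  deviation, leaving only gradient differences that Gronwall controls.\<close>

lemma flow_invariant:
  fixes W :: "nat \<Rightarrow> real \<Rightarrow> real ^ 'd ^ 'd"
  assumes flow: "\<And>l t. l \<in> {1..L} \<Longrightarrow> t \<ge> 0 \<Longrightarrow> (W l has_vector_derivative
      - loss_grad (Omega_block idx s n) w L (\<lambda>k. W k t) l) (at t within {0..})"
    and init: "\<And>l. l \<in> {1..L} \<Longrightarrow> W l 0 = spec a b c"
    and l: "l \<in> {1..L}" and T: "T \<ge> 0"
  shows "W l T = proj (W 1 T)"
proof -
  define P where "P = (\<lambda>t. proj (W 1 t))"
  define G where "G V l t = loss_grad (Omega_block idx s n) w L (\<lambda>k. V k t) l"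
    for V :: "nat \<Rightarrow> real \<Rightarrow> real ^ 'd ^ 'd" and l t
  define E where "E l t = W l t - P t" for l t
  define E' where "E' l t = - (G W l t - G (\<lambda>k. P) l t) + proj (G W 1 t - G (\<lambda>k. P) 1 t)" for l t
  define e where "e t = L2_set (\<lambda>j. norm (E j t)) {1..L}" for t
  have one: "1 \<in> {1..L}"
    using l by auto
  interpret proj: bounded_linear proj
    by (rule bounded_linear_proj)
  have e: "e t \<ge> 0" for t
    by (simp add: e_def L2_set_nonneg)
  have GP: "proj (G (\<lambda>k. P) 1 t) = G (\<lambda>k. P) l t" if "l \<in> {1..L}" for l t
    unfolding G_def P_def proj_def[of "W 1 t"] using that one by (simp only: loss_grad_spec proj_spec)
  have der: "(E l has_vector_derivative E' l t) (at t within {0..})" if "l \<in> {1..L}" "t \<ge> 0" for l t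
  proof -
    have "(E l has_vector_derivative - G W l t - proj (- G W 1 t)) (at t within {0..})"
      unfolding E_def P_def G_def using that one
      by (intro has_vector_derivative_diff proj.has_vector_derivative flow)
    moreover have "- G W l t - proj (- G W 1 t) = E' l t"
      using GP[OF that(1), of t] by (simp add: E'_def proj.diff linear_neg[OF proj.linear])
    ultimately show ?thesis
      by simp
  qed
  have cont: "continuous_on {0..T} (W l)" if "l \<in> {1..L}" for l
    by (rule continuous_on_subset[of "{0..}"])
      (use that in \<open>auto simp: continuous_on_eq_continuous_within
        intro!: has_vector_derivative_continuous[OF flow]\<close>)
  have bounded: "\<exists>K\<ge>0. \<forall>t\<in>{0..T}. norm (f t) \<le> K" if "continuous_on {0..T} f"
    for f :: "real \<Rightarrow> real ^ 'd ^ 'd"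
    using compact_imp_bounded[OF compact_continuous_image[OF that compact_Icc]]
    unfolding bounded_pos by (auto intro: less_imp_le)
  have "close_along T e (W l) P" if l: "l \<in> {1..L}" for l
  proof -
    obtain K where K: "K \<ge> 0" "\<And>t. t \<in> {0..T} \<Longrightarrow> norm (W l t) \<le> K"
      using bounded[OF cont[OF l]] by blast
    have "continuous_on {0..T} P"
      unfolding P_def by (rule proj.continuous_on[OF cont[OF one]])
    then obtain M where M: "M \<ge> 0" "\<And>t. t \<in> {0..T} \<Longrightarrow> norm (P t) \<le> M"
      using bounded by blast
    \<comment> \<open>The deviation needs the constant 1 and the norms need \<open>K\<close> and
      \<open>M\<close>; their sum serves as the single constant in
      \<open>close_along\<close>.\<close>
    have "norm (W l t - P t) \<le> (1 + K + M) * e t" for t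
    proof -
      have "norm (W l t - P t) \<le> 1 * e t"
        unfolding e_def using member_le_L2_set[of "{1..L}" l "\<lambda>j. norm (E j t)"] l by (simp add: E_def)
      also have "\<dots> \<le> (1 + K + M) * e t"
        using K(1) M(1) e by (intro mult_right_mono) auto
      finally show ?thesis .
    qed
    moreover have "norm (W l t) \<le> 1 + K + M" "norm (P t) \<le> 1 + K + M" if "t \<in> {0..T}" for t
      using K(1) K(2)[OF that] M(1) M(2)[OF that] by auto
    moreover have "0 \<le> 1 + K + M"
      using K(1) M(1) by simp
    ultimately show ?thesis
      unfolding close_along_def by blast
  qed
  then have "close_along T e (G W l) (G (\<lambda>k. P) l)" if "l \<in> {1..L}" for l
    unfolding G_def using close_along_loss_grad[of e L T W "\<lambda>k. P"] e that by blast
  then have "\<forall>l\<in>{1..L}. \<exists>K\<ge>0. \<forall>t\<in>{0..T}. norm (G W l t - G (\<lambda>k. P) l t) \<le> K * e t"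
    unfolding close_along_def by blast
  then obtain K where K: "\<And>l. l \<in> {1..L} \<Longrightarrow> K l \<ge> 0"
    "\<And>l t. l \<in> {1..L} \<Longrightarrow> t \<in> {0..T} \<Longrightarrow> norm (G W l t - G (\<lambda>k. P) l t) \<le> K l * e t"
    by metis
  obtain B where B: "B \<ge> 0" "\<And>X. norm (proj X) \<le> norm X * B"
    using proj.nonneg_bounded by blast
  define M where "M = (\<Sum>l\<in>{1..L}. K l)"
  have M: "norm (G W l t - G (\<lambda>k. P) l t) \<le> M * e t" if "l \<in> {1..L}" "t \<in> {0..T}" for l t
  proof -
    have "K l \<le> M"
      unfolding M_def using that K(1) by (intro member_le_sum) auto
    then have "K l * e t \<le> M * e t"
      using e by (intro mult_right_mono)
    then show ?thesis
      using K(2)[OF that] by linarith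
  qed
  have "E l T = 0"
  \<comment> \<open>\<open>M\<close> accounts for the gradient difference in the layer itself,
    \<open>M * B\<close> for the projected one in the first layer.\<close>
  proof (rule gronwall_system[of "{1..L}" E E' T "M + M * B"])
    fix l t assume lt: "l \<in> {1..L}" "0 \<le> t" "t \<le> T"
    then have t: "t \<in> {0..T}"
      by simp
    have "norm (proj (G W 1 t - G (\<lambda>k. P) 1 t)) \<le> M * e t * B"
      using B(2) mult_right_mono[OF M[OF one t] B(1)] by (rule order_trans)
    then have "norm (E' l t) \<le> M * e t + M * e t * B"
      unfolding E'_def using M[OF lt(1) t] by (intro norm_triangle_mono) (auto simp: norm_minus_commute)
    then show "norm (E' l t) \<le> (M + M * B) * L2_set (\<lambda>j. norm (E j t)) {1..L}"
      by (simp add: e_def algebra_simps)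
  next
    fix l assume "l \<in> {1..L}"
    then show "E l 0 = 0"
      using one by (simp add: E_def P_def init proj_spec)
  qed (use der l T in auto)
  then show ?thesis
    by (simp add: E_def P_def)
qed

lemma flow_limit:
  fixes W :: "nat \<Rightarrow> real \<Rightarrow> real ^ 'd ^ 'd" and w :: real
  assumes flow: "\<And>l t. l \<in> {1..L} \<Longrightarrow> t \<ge> 0 \<Longrightarrow> (W l has_vector_derivative
      - loss_grad (Omega_block idx s n) w L (\<lambda>k. W k t) l) (at t within {0..})"
    and start: "\<And>l. l \<in> {1..L} \<Longrightarrow> W l 0 = spec x0 y0 z0"
    and L: "L \<ge> 3" and w: "w > 0" and order: "0 < y0" "y0 < x0"
  obtains a b where "((\<lambda>t. layer_prod (\<lambda>l. W l t) L) \<longlongrightarrow> spec (a ^ L) (b ^ L) 0) at_top"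
    "a > 0" "b \<ge> 0" "a ^ L / n + (1 - 1 / n) * b ^ L = w * s"
    "b ^ (L - 2) * (1 / y0 ^ (L - 2) - 1 / x0 ^ (L - 2)) \<le> 1"
proof -
  define x y z where "x t = eig1 (W 1 t)" and "y t = eig2 (W 1 t)" and "z t = eig3 (W 1 t)" for t
  define \<mu> where "\<mu> t = x t ^ L / n + (1 - 1 / n) * y t ^ L - w * s" for t
  have one: "1 \<in> {1..L}"
    using L by auto
  have W: "W l t = spec (x t) (y t) (z t)" if "l \<in> {1..L}" "t \<ge> 0" for l t
    using flow_invariant[OF flow start that] by (simp add: proj_def x_def y_def z_def)
  have grad: "loss_grad (Omega_block idx s n) w L (\<lambda>k. W k t) 1 =
      spec (x t ^ (L - 1) * \<mu> t) (y t ^ (L - 1) * \<mu> t) (z t ^ (2 * L - 1))" if t: "t \<ge> 0" for t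
  proof -
    have "loss_grad (Omega_block idx s n) w L (\<lambda>k. W k t) 1 =
        loss_grad (Omega_block idx s n) w L (\<lambda>k. spec (x t) (y t) (z t)) 1"
      unfolding loss_grad_def using W t L
      by (intro arg_cong2[of _ _ _ _ "(**)"] arg_cong[of _ _ transpose] arg_cong[of _ _ "mask _"]
          arg_cong2[of _ _ _ _ minus] layer_prod_cong refl) auto
    also have "\<dots> = spec (x t ^ (L - 1) * \<mu> t) (y t ^ (L - 1) * \<mu> t) (z t ^ (2 * L - 1))"
      unfolding \<mu>_def by (rule loss_grad_spec[OF one])
    finally show ?thesis .
  qed
  have der: "((\<lambda>t. h (W 1 t)) has_real_derivative
      h (- spec (x t ^ (L - 1) * \<mu> t) (y t ^ (L - 1) * \<mu> t) (z t ^ (2 * L - 1)))) (at t within {0..})"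
    if "bounded_linear h" "t \<ge> 0" for h t
    using bounded_linear.has_vector_derivative[OF that(1) flow[OF one that(2)]] grad[OF that(2)]
    by (simp add: has_real_derivative_iff_has_vector_derivative)
  define p where "p = L - 2"
  have pL: "p > 0" "L = p + 2"
    using L by (auto simp: p_def)
  interpret coupled_flow x y \<mu> p "1 / n" "w * s"
  proof
    show "(x has_real_derivative - (x t ^ (p + 1) * \<mu> t)) (at t within {0..})" if "t \<ge> 0" for t
      using der[OF bounded_linear_eig(1) that]
      unfolding spec_uminus eig_spec x_def[symmetric] by (simp add: pL(2))
    show "(y has_real_derivative - (y t ^ (p + 1) * \<mu> t)) (at t within {0..})" if "t \<ge> 0" for t
      using der[OF bounded_linear_eig(2) that]
      unfolding spec_uminus eig_spec y_def[symmetric] by (simp add: pL(2))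
    show "0 < y 0" "y 0 < x 0"
      using order start[OF one] by (simp_all add: x_def y_def eig_spec)
  qed (use pL(1) n s w in \<open>auto simp: \<mu>_def pL(2)\<close>)
  have xy0: "x 0 = x0" "y 0 = y0"
    using start[OF one] by (simp_all add: x_def y_def eig_spec)
  have z: "(z \<longlongrightarrow> 0) at_top"
  proof (rule odd_power_decay[of _ "L - 1"])
    fix t :: real assume t: "t \<ge> 0"
    \<comment> \<open>For \<open>s = 1\<close> the division by zero makes \<open>z\<close> vanish
      identically, so both sides of the equation below are 0; otherwise
      \<open>2 * (L - 1) + 1 = 2 * L - 1\<close>.\<close>
    have "z t = 0" if "s = 1"
      unfolding z_def eig3_def using that by simp
    then have eq: "eig3 (- spec (x t ^ (L - 1) * \<mu> t) (y t ^ (L - 1) * \<mu> t) (z t ^ (2 * L - 1)))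
        = - (z t ^ (2 * (L - 1) + 1))"
      using L unfolding spec_uminus eig_spec by (auto simp: pL(2))
    then show "(z has_real_derivative - (z t ^ (2 * (L - 1) + 1))) (at t within {0..})"
      using der[OF bounded_linear_eig(3) t] unfolding eq z_def[symmetric] by simp
  qed
  obtain a b where ab: "(x \<longlongrightarrow> a) at_top" "(y \<longlongrightarrow> b) at_top" "a > 0" "b \<ge> 0"
    "1 / n * a ^ (p + 2) + (1 - 1 / n) * b ^ (p + 2) = w * s"
    "b ^ p * (1 / y 0 ^ p - 1 / x 0 ^ p) \<le> 1"
    by (rule limit_values)
  have "((\<lambda>t. spec (x t ^ L) (y t ^ L) (z t ^ L)) \<longlongrightarrow> spec (a ^ L) (b ^ L) (0 ^ L)) at_top"
    unfolding spec_def using s n by (intro tendsto_intros ab z) auto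
  moreover have "spec (x t ^ L) (y t ^ L) (z t ^ L) = layer_prod (\<lambda>l. W l t) L" if "t \<ge> 0" for t
    unfolding layer_prod_spec[symmetric] using W that by (intro layer_prod_cong) auto
  then have "\<forall>\<^sub>F t in at_top. spec (x t ^ L) (y t ^ L) (z t ^ L) = layer_prod (\<lambda>l. W l t) L"
    using eventually_ge_at_top[of 0] by (rule eventually_mono[rotated])
  ultimately have "((\<lambda>t. layer_prod (\<lambda>l. W l t) L) \<longlongrightarrow> spec (a ^ L) (b ^ L) 0) at_top"
    using L by (auto simp: power_0_left cong: filterlim_cong elim: Lim_transform_eventually)
  then show ?thesis
    by (rule that) (use ab xy0 pL in auto)
qed

section \<open>Stable rank of the limiting product\<close>

lemma srank_spec_bounds:
  assumes "x > 0"
  shows "1 \<le> srank (spec x y 0)" "srank (spec x y 0) \<le> (x\<^sup>2 + y\<^sup>2 * (real n - 1)) / x\<^sup>2"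
proof -
  let ?A = "spec x y 0" and ?v = "1 :: real ^ 'd"
  have A: "(norm ?A)\<^sup>2 = x\<^sup>2 + y\<^sup>2 * (real n - 1)"
    unfolding power2_norm_eq_inner inner_spec by (simp add: power2_eq_square)
  have "(?A *v ?v) $ i = x" for i
  proof -
    have "(?A *v ?v) $ i = (\<Sum>j\<in>UNIV. (x - y) / (s * n) + (if blk i = blk j then y / s else 0))"
      by (auto simp: spec_def matrix_vector_mult_def ones_def blocks_def intro!: sum.cong)
    also have "\<dots> = x"
      unfolding sum.distrib sum_block using s n by (simp add: card_index)
    finally show ?thesis .
  qed
  then have "?A *v ?v = x *\<^sub>R ?v"
    by (simp add: vec_eq_iff)
  \<comment> \<open>The vector \<open>1\<close> has all entries 1 and is an eigenvector for
    \<open>x\<close>, which bounds the spectral norm from below.\<close>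
  moreover have "norm (?A *v ?v) \<le> onorm ((*v) ?A) * norm ?v"
    by (rule onorm) (rule matrix_vector_mul_bounded_linear)
  ultimately have x: "x \<le> onorm ((*v) ?A)"
    using assms by simp
  moreover have "onorm ((*v) ?A) \<le> norm ?A"
    by (rule onorm_le) (rule norm_matrix_vector_mult_le)
  ultimately have le: "(onorm ((*v) ?A))\<^sup>2 \<le> (norm ?A)\<^sup>2" "x\<^sup>2 \<le> (onorm ((*v) ?A))\<^sup>2"
    using assms by (auto intro!: power_mono)
  have x2: "x\<^sup>2 > 0"
    using assms by simp
  with le(2) have o: "(onorm ((*v) ?A))\<^sup>2 > 0"
    by linarith
  show "1 \<le> srank ?A"
    unfolding srank_def using o le(1) by (simp only: le_divide_eq_1_pos)
  show "srank ?A \<le> (x\<^sup>2 + y\<^sup>2 * (real n - 1)) / x\<^sup>2"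
    unfolding srank_def A[symmetric] by (rule divide_left_mono[OF le(2) zero_le_power2 mult_pos_pos[OF o x2]])
qed

end

theorem corollary3p4:
  fixes m w :: real and n s L :: nat
    and idx :: "'d::finite \<Rightarrow> nat"
    and W :: "real \<Rightarrow> nat \<Rightarrow> real \<Rightarrow> real ^ 'd ^ 'd"
  assumes "1 < m" and "n \<ge> 2" and "s \<ge> 1" and "w > 0" and "L \<ge> 3"
    and "bij_betw idx UNIV {1..s * n}"
    and "\<And>\<alpha> l. \<alpha> > 0 \<Longrightarrow> l \<in> {1..L} \<Longrightarrow> W \<alpha> l 0 = init_matrix \<alpha> m"
    and "\<And>\<alpha>. \<alpha> > 0 \<Longrightarrow> gradient_flow (block_loss idx s n w L) L (W \<alpha>)"
  shows "\<exists>Winf :: real \<Rightarrow> real ^ 'd ^ 'd.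
           (\<forall>\<alpha>>0. ((\<lambda>t. layer_prod (\<lambda>l. W \<alpha> l t) L) \<longlongrightarrow> Winf \<alpha>) at_top) \<and>
           ((\<lambda>\<alpha>. srank (Winf \<alpha>)) \<longlongrightarrow> 1) (at_right 0)"
proof -
  interpret block_indexing idx s n
    by standard (use assms in auto)
  define p where "p = L - 2"
  have p: "p > 0" "L > 0"
    using \<open>L \<ge> 3\<close> by (auto simp: p_def)
  \<comment> \<open>These are the initial eigenvalues at \<open>\<alpha> = 1\<close>; in general
    they scale linearly with \<alpha>.\<close>
  define y0 x0 where "y0 = 1 - 1 / m" and "x0 = 1 - 1 / m + 1 / m * (s * n)"
  have xy0: "0 < y0" "y0 < x0"
    using assms(1-3) by (auto simp: y0_def x0_def)
  define Q where "Q = 1 / y0 ^ p - 1 / x0 ^ p"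
  have "y0 ^ p < x0 ^ p"
    using xy0 p by (intro power_strict_mono) auto
  then have Q: "Q > 0"
    using xy0 by (simp add: Q_def field_simps)
  have "\<exists>a b. ((\<lambda>t. layer_prod (\<lambda>l. W \<alpha> l t) L) \<longlongrightarrow> spec (a ^ L) (b ^ L) 0) at_top \<and>
      a > 0 \<and> b \<ge> 0 \<and> a ^ L / n + (1 - 1 / n) * b ^ L = w * s \<and> b ^ p \<le> \<alpha> ^ p / Q"
    if \<alpha>: "\<alpha> > 0" for \<alpha>
  proof -
    have init: "W \<alpha> l 0 = spec (\<alpha> * x0) (\<alpha> * y0) (\<alpha> * y0)" if "l \<in> {1..L}" for l
      unfolding assms(7)[OF \<alpha> that] init_matrix_eq x0_def y0_def by (simp add: algebra_simps)
    obtain a b where ab: "((\<lambda>t. layer_prod (\<lambda>l. W \<alpha> l t) L) \<longlongrightarrow> spec (a ^ L) (b ^ L) 0) at_top"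
      "a > 0" "b \<ge> 0" "a ^ L / n + (1 - 1 / n) * b ^ L = w * s"
      "b ^ p * (1 / (\<alpha> * y0) ^ p - 1 / (\<alpha> * x0) ^ p) \<le> 1"
      unfolding p_def using flow_limit[OF gradient_flow_block_loss[OF assms(8)[OF \<alpha>]] init assms(5,4)]
        xy0 \<alpha> by (auto simp: mult_strict_left_mono)
    \<comment> \<open>The conserved quantity is homogeneous of degree \<open>- p\<close> in
      \<alpha>, so it blows up as \<alpha> tends to 0 and forces \<open>b\<close> to be
      small.\<close>
    have "1 / (\<alpha> * y0) ^ p - 1 / (\<alpha> * x0) ^ p = Q / \<alpha> ^ p"
      by (simp add: Q_def power_mult_distrib diff_divide_distrib mult.commute)
    with ab(5) have "b ^ p \<le> \<alpha> ^ p / Q"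
      using Q \<alpha> by (simp add: pos_le_divide_eq)
    with ab show ?thesis
      by blast
  qed
  then obtain a b where
    lim: "\<And>\<alpha>. \<alpha> > 0 \<Longrightarrow>
      ((\<lambda>t. layer_prod (\<lambda>l. W \<alpha> l t) L) \<longlongrightarrow> spec (a \<alpha> ^ L) (b \<alpha> ^ L) 0) at_top" and
    a: "\<And>\<alpha>. \<alpha> > 0 \<Longrightarrow> a \<alpha> > 0" and b: "\<And>\<alpha>. \<alpha> > 0 \<Longrightarrow> b \<alpha> \<ge> 0" and
    balance: "\<And>\<alpha>. \<alpha> > 0 \<Longrightarrow> a \<alpha> ^ L / n + (1 - 1 / n) * b \<alpha> ^ L = w * s" and
    small: "\<And>\<alpha>. \<alpha> > 0 \<Longrightarrow> b \<alpha> ^ p \<le> \<alpha> ^ p / Q"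
    by metis
  have pos: "\<forall>\<^sub>F \<alpha> :: real in at_right 0. \<alpha> > 0"
    by (rule eventually_at_right_less)
  have "((\<lambda>\<alpha> :: real. \<alpha> ^ p / Q) \<longlongrightarrow> 0 ^ p / Q) (at_right 0)"
    by (intro tendsto_intros) (use Q in auto)
  then have "((\<lambda>\<alpha>. b \<alpha> ^ p) \<longlongrightarrow> 0) (at_right 0)"
    by (intro tendsto_sandwich[of "\<lambda>_. 0" "\<lambda>\<alpha>. b \<alpha> ^ p" _ "\<lambda>\<alpha>. \<alpha> ^ p / Q"])
      (use p in \<open>auto intro!: eventually_mono[OF pos] small zero_le_power b simp: power_0_left\<close>)
  then have "((\<lambda>\<alpha>. root p (b \<alpha> ^ p)) \<longlongrightarrow> root p 0) (at_right 0)"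
    by (rule tendsto_real_root)
  moreover have "\<forall>\<^sub>F \<alpha> in at_right 0. root p (b \<alpha> ^ p) = b \<alpha>"
    using p by (auto intro!: eventually_mono[OF pos] real_root_power_cancel b)
  ultimately have "(b \<longlongrightarrow> 0) (at_right 0)"
    by (simp add: filterlim_cong)
  from tendsto_power[OF this, of L] p have bL: "((\<lambda>\<alpha>. b \<alpha> ^ L) \<longlongrightarrow> 0) (at_right 0)"
    by (simp add: power_0_left)
  \<comment> \<open>Solving the vanishing-residual equation for \<open>a \<alpha> ^ L\<close> gives
    its limit \<open>n * (w * s)\<close>, whose positivity makes the quotient below
    converge.\<close>
  have "((\<lambda>\<alpha>. n * (w * s - (1 - 1 / n) * b \<alpha> ^ L)) \<longlongrightarrow> n * (w * s - (1 - 1 / n) * 0)) (at_right 0)"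
    by (intro tendsto_intros bL)
  moreover have "\<forall>\<^sub>F \<alpha> in at_right 0. n * (w * s - (1 - 1 / n) * b \<alpha> ^ L) = a \<alpha> ^ L"
    using pos
  proof eventually_elim
    case (elim \<alpha>)
    then show ?case
      using balance[OF elim, symmetric] n by simp
  qed
  ultimately have aL: "((\<lambda>\<alpha>. a \<alpha> ^ L) \<longlongrightarrow> n * (w * s)) (at_right 0)"
    by (simp add: filterlim_cong)
  have nws: "n * (w * s) > 0"
    using assms by simp
  have "((\<lambda>\<alpha>. ((a \<alpha> ^ L)\<^sup>2 + (b \<alpha> ^ L)\<^sup>2 * (real n - 1)) / (a \<alpha> ^ L)\<^sup>2) \<longlongrightarrow>
      ((n * (w * s))\<^sup>2 + 0\<^sup>2 * (real n - 1)) / (n * (w * s))\<^sup>2) (at_right 0)"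
    using nws by (intro tendsto_intros aL bL) (use n s in auto)
  then have upper: "((\<lambda>\<alpha>. ((a \<alpha> ^ L)\<^sup>2 + (b \<alpha> ^ L)\<^sup>2 * (real n - 1)) / (a \<alpha> ^ L)\<^sup>2) \<longlongrightarrow> 1) (at_right 0)"
    using n s \<open>w > 0\<close> by auto
  have "((\<lambda>\<alpha>. srank (spec (a \<alpha> ^ L) (b \<alpha> ^ L) 0)) \<longlongrightarrow> 1) (at_right 0)"
    by (rule tendsto_sandwich[OF _ _ tendsto_const upper])
      (auto intro!: eventually_mono[OF pos] srank_spec_bounds zero_less_power a)
  with lim show ?thesis
    by (intro exI[of _ "\<lambda>\<alpha>. spec (a \<alpha> ^ L) (b \<alpha> ^ L) 0"]) auto
qed

end
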